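(* Let $K$ be a field and consider the Chevalley group of type $E_6$ over $K$, with root elements $x_r(t)$ ($r\in E_6$, $t\in K$) defined by a Chevalley basis of the complex simple Lie algebra of type $E_6$ in which the structure constants of all extraspecial pairs are equal to $1$. For positive roots $p\prec q$ with $p+q\in E_6$ put $\eta_{p,q}=-1$ if $(p,q)$ is one of the following 34 pairs, and $\eta_{p,q}=1$ otherwise: $p=a+c$ and $q\in\{b+c+2d+e,\ b+c+2d+e+f,\ b+c+2d+2e+f\}$; $p=c+d$ and $q\in\{b+d+e,\ b+d+e+f,\ a+b+c+2d+2e+f\}$; $p=a+c+d$ and $q\in\{b+d+e,\ b+c+d+e,\ b+d+e+f,\ b+c+d+e+f\}$; $p=b+d$ and $q\in\{e,\ e+f,\ a+b+2c+2d+2e+f\}$; $p=b+c+d$ and $q\in\{e,\ d+e,\ e+f,\ d+e+f\}$; $p=a+b+c+d$ and $q\in\{e,\ d+e,\ c+d+e,\ e+f,\ d+e+f,\ c+d+e+f,\ b+c+2d+2e+f\}$; $p=d+e$ and $q\in\{b+c+d+e+f,\ a+b+c+d+e+f\}$; $p=c+d+e$ and $q\in\{a+b+c+d+e+f,\ a+b+c+2d+e+f\}$; $p=b+c+d+e$ and $q\in\{d+e+f,\ a+b+c+2d+e+f\}$; $p=a+b+c+d+e$ and $q\in\{d+e+f,\ c+d+e+f\}$; $p=a+b+c+2d+e$ and $q\in\{c+d+e+f,\ b+c+d+e+f\}$. Then for all positive roots $p\prec q$ with $p+q\in E_6$ and all $u,t\in K$: $$[x_p(u),x_q(t)]=x_{p+q}(\eta_{p,q}\,tu),\qquad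 [x_{-p}(u),x_{-q}(t)]=x_{-p-q}(-\eta_{p,q}\,tu),$$ $$[x_p(u),x_{-p-q}(t)]=x_{-q}(-\eta_{p,q}\,tu),\qquad [x_q(u),x_{-p-q}(t)]=x_{-p}(\eta_{p,q}\,tu).$$
   Context: Root system. In $\mathbb{R}^8$ with orthonormal basis $e_1,\dots,e_8$ (these vectors are used only here), the root system $E_6$ consists of the vectors $\pm e_i\pm e_j$ ($1\le i<j\le 5$) and $\pm\frac12\bigl(e_8-e_7-e_6+\sum_{i=1}^5(-1)^{\nu(i)}e_i\bigr)$ with $\nu(i)\in\{0,1\}$ and $\sum_{i=1}^5\nu(i)$ even. The simple roots are $a=\frac12(e_1+e_8-e_2-e_3-e_4-e_5-e_6-e_7)$, $b=e_1+e_2$, $c=e_2-e_1$, $d=e_3-e_2$, $e=e_4-e_3$, $f=e_5-e_4$. (So the Dynkin diagram is the chain $a,c,d,e,f$ with $b$ attached to $d$.) Order. On the span of the simple roots, $x\prec y$ means that in the expansion $y-x=\tau_1 f+\tau_2 e+\tau_3 b+\tau_4 d+\tau_5 c+\tau_6 a$ the first non-zero coefficient among $\tau_1,\tau_2,\dots,\tau_6$ (in this order) is positive. The roots $r$ with $0\prec r$ are exactly the positive roots. Extraspecial pairs. An ordered pair of roots $(r,s)$ is special if $0\prec r\prec s$ and $r+s\in E_6$. A special pair $(r,s)$ is extraspecial if $r\preceq r_1$ for every special pair $(r_1,s_1)$ with $r_1+s_1=r+s$. Structure constants. $e_r$ ($r\in E_6$) are the root vectors of a Chevalley basis: $[e_r,e_{-r}]=h_r$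 is the coroot of $r$, and $[e_r,e_s]=N_{r,s}e_{r+s}$ with $N_{r,s}=\pm1$ when $r,s,r+s\in E_6$. Group. $x_r(t)$ is the automorphism $\exp(t\,\mathrm{ad}\,e_r)$ of the Lie algebra over $K$ obtained from the Chevalley basis by extension of scalars from $\mathbb{Z}$ (Carter's convention), and the Chevalley group is generated by all $x_r(t)$. The group commutator is $[x,y]=x^{-1}y^{-1}xy$. *)

theory Defs
  imports "HOL-Analysis.Analysis" "HOL-Algebra.Bij" "HOL-Algebra.Generated_Groups"
begin

section \<open>The root system\<close>

text \<open>The index type \<open>8\<close> is the integers modulo 8, so \<open>1, \<dots>, 8\<close> are its eight distinct
  elements (with \<open>8 = 0\<close>).\<close>

definition eps :: "nat \<Rightarrow> real ^ 8" where
  "eps i = axis (of_nat i) 1"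

definition E6 :: "(real ^ 8) set" where
  "E6 = {\<sigma> *\<^sub>R eps i + \<tau> *\<^sub>R eps j | \<sigma> \<tau> i j.
            \<sigma> \<in> {1, -1} \<and> \<tau> \<in> {1, -1} \<and> 1 \<le> i \<and> i < j \<and> j \<le> 5} \<union>
        {\<sigma> *\<^sub>R (1/2) *\<^sub>R (eps 8 - eps 7 - eps 6 + (\<Sum>i = 1..5. (-1) ^ \<nu> i *\<^sub>R eps i)) | \<sigma> \<nu>.
            \<sigma> \<in> {1, -1} \<and> (\<forall>i\<in>{1..5}. \<nu> i \<in> {0, 1 :: nat}) \<and> even (\<Sum>i = 1..5. \<nu> i)}"

definition ra :: "real ^ 8" where
  "ra = (1/2) *\<^sub>R (eps 1 + eps 8 - eps 2 - eps 3 - eps 4 - eps 5 - eps 6 - eps 7)"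
definition rb :: "real ^ 8" where "rb = eps 1 + eps 2"
definition rc :: "real ^ 8" where "rc = eps 2 - eps 1"
definition rd :: "real ^ 8" where "rd = eps 3 - eps 2"
definition re :: "real ^ 8" where "re = eps 4 - eps 3"
definition rf :: "real ^ 8" where "rf = eps 5 - eps 4"

definition simple_roots :: "(real ^ 8) set" where
  "simple_roots = {ra, rb, rc, rd, re, rf}"

definition prec :: "real ^ 8 \<Rightarrow> real ^ 8 \<Rightarrow> bool" (infix "\<prec>" 50) where
  "x \<prec> y \<longleftrightarrow> (\<exists>\<tau> :: nat \<Rightarrow> real.
      y - x = \<tau> 1 *\<^sub>R rf + \<tau> 2 *\<^sub>R re + \<tau> 3 *\<^sub>R rb + \<tau> 4 *\<^sub>R rd + \<tau> 5 *\<^sub>R rc + \<tau> 6 *\<^sub>R ra \<and>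
      (\<exists>k\<in>{1..6}. 0 < \<tau> k \<and> (\<forall>j\<in>{1..<k}. \<tau> j = 0)))"

definition preceq :: "real ^ 8 \<Rightarrow> real ^ 8 \<Rightarrow> bool" (infix "\<preceq>" 50) where
  "x \<preceq> y \<longleftrightarrow> x \<prec> y \<or> x = y"

definition positive_roots :: "(real ^ 8) set" where
  "positive_roots = {r \<in> E6. 0 \<prec> r}"

definition special :: "real ^ 8 \<Rightarrow> real ^ 8 \<Rightarrow> bool" where
  "special r s \<longleftrightarrow> r \<in> E6 \<and> s \<in> E6 \<and> 0 \<prec> r \<and> r \<prec> s \<and> r + s \<in> E6"

definition extraspecial :: "real ^ 8 \<Rightarrow> real ^ 8 \<Rightarrow> bool" where
  "extraspecial r s \<longleftrightarrow> special r s \<and>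
     (\<forall>r1 s1. special r1 s1 \<and> r1 + s1 = r + s \<longrightarrow> r \<preceq> r1)"

definition exceptional_pairs :: "((real ^ 8) \<times> (real ^ 8)) set" where
  "exceptional_pairs = (let a = ra; b = rb; c = rc; d = rd; e = re; f = rf in
     {a + c} \<times> {b + c + 2 *\<^sub>R d + e, b + c + 2 *\<^sub>R d + e + f, b + c + 2 *\<^sub>R d + 2 *\<^sub>R e + f} \<union>
     {c + d} \<times> {b + d + e, b + d + e + f, a + b + c + 2 *\<^sub>R d + 2 *\<^sub>R e + f} \<union>
     {a + c + d} \<times> {b + d + e, b + c + d + e, b + d + e + f, b + c + d + e + f} \<union>
     {b + d} \<times> {e, e + f, a + b + 2 *\<^sub>R c + 2 *\<^sub>R d + 2 *\<^sub>R e + f} \<union>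
     {b + c + d} \<times> {e, d + e, e + f, d + e + f} \<union>
     {a + b + c + d} \<times> {e, d + e, c + d + e, e + f, d + e + f, c + d + e + f,
                        b + c + 2 *\<^sub>R d + 2 *\<^sub>R e + f} \<union>
     {d + e} \<times> {b + c + d + e + f, a + b + c + d + e + f} \<union>
     {c + d + e} \<times> {a + b + c + d + e + f, a + b + c + 2 *\<^sub>R d + e + f} \<union>
     {b + c + d + e} \<times> {d + e + f, a + b + c + 2 *\<^sub>R d + e + f} \<union>
     {a + b + c + d + e} \<times> {d + e + f, c + d + e + f} \<union>
     {a + b + c + 2 *\<^sub>R d + e} \<times> {c + d + e + f, b + c + d + e + f})"

definition eta :: "real ^ 8 \<Rightarrow> real ^ 8 \<Rightarrow> 'k::field" where
  "eta p q = (if (p, q) \<in> exceptional_pairs then - 1 else 1)"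


section \<open>Complex Lie algebras\<close>

locale complex_lie_algebra = vector_space scale
  for scale :: "complex \<Rightarrow> 'l::ab_group_add \<Rightarrow> 'l" +
  fixes bracket :: "'l \<Rightarrow> 'l \<Rightarrow> 'l"
  assumes bracket_add_left: "bracket (x + y) z = bracket x z + bracket y z"
    and bracket_add_right: "bracket x (y + z) = bracket x y + bracket x z"
    and bracket_scale_left: "bracket (scale c x) y = scale c (bracket x y)"
    and bracket_scale_right: "bracket x (scale c y) = scale c (bracket x y)"
    and bracket_self: "bracket x x = 0"
    and jacobi: "bracket x (bracket y z) + bracket y (bracket z x) + bracket z (bracket x y) = 0"
begin

definition lie_ideal :: "'l set \<Rightarrow> bool" where
  "lie_ideal I \<longleftrightarrow> subspace I \<and> (\<forall>x. \<forall>y\<in>I. bracket x y \<in> I)"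

definition simple :: bool where
  "simple \<longleftrightarrow> (\<exists>x y. bracket x y \<noteq> 0) \<and> (\<forall>I. lie_ideal I \<longrightarrow> I = {0} \<or> I = UNIV)"

primrec lower_central :: "'l set \<Rightarrow> nat \<Rightarrow> 'l set" where
  "lower_central H 0 = H"
| "lower_central H (Suc n) = span {bracket x y | x y. x \<in> H \<and> y \<in> lower_central H n}"

definition cartan_subalgebra :: "'l set \<Rightarrow> bool" where
  "cartan_subalgebra H \<longleftrightarrow>
     subspace H \<and> (\<forall>x\<in>H. \<forall>y\<in>H. bracket x y \<in> H) \<and>
     (\<exists>n. lower_central H n = {0}) \<and>
     {x. \<forall>h\<in>H. bracket x h \<in> H} = H"

definition root_space :: "'l set \<Rightarrow> ('l \<Rightarrow> complex) \<Rightarrow> 'l set" where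
  "root_space H \<alpha> = {x. \<forall>h\<in>H. bracket h x = scale (\<alpha> h) x}"

text \<open>Functionals on \<open>H\<close> are represented by functions that are extensional on \<open>H\<close>.  A function
  with a non-zero root space is automatically linear on \<open>H\<close>.\<close>

definition lie_roots :: "'l set \<Rightarrow> ('l \<Rightarrow> complex) set" where
  "lie_roots H = {\<alpha> \<in> extensional H. (\<exists>h\<in>H. \<alpha> h \<noteq> 0) \<and> root_space H \<alpha> \<noteq> {0}}"

definition is_coroot :: "'l set \<Rightarrow> ('l \<Rightarrow> complex) \<Rightarrow> 'l \<Rightarrow> bool" where
  "is_coroot H \<alpha> h \<longleftrightarrow> h \<in> H \<and> \<alpha> h = 2 \<and>
     h \<in> span {bracket x y | x y. x \<in> root_space H \<alpha> \<and> y \<in> root_space H (\<lambda>h. - \<alpha> h)}"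

text \<open>\<open>\<phi>\<close> is an isomorphism of root systems from \<^const>\<open>E6\<close> to the roots with respect to \<open>H\<close>:
  it is real-linear, maps roots bijectively to roots and preserves Cartan integers.  Only its
  values on the span of \<^const>\<open>E6\<close> matter.\<close>

definition simple_of_type_E6 :: "'l set \<Rightarrow> (real ^ 8 \<Rightarrow> 'l \<Rightarrow> complex) \<Rightarrow> bool" where
  "simple_of_type_E6 H \<phi> \<longleftrightarrow>
     simple \<and> (\<exists>B. finite B \<and> span B = UNIV) \<and> cartan_subalgebra H \<and>
     (\<forall>h\<in>H. linear (\<lambda>v. \<phi> v h)) \<and>
     bij_betw \<phi> E6 (lie_roots H) \<and>
     (\<forall>r\<in>E6. \<forall>s\<in>E6. \<forall>h. is_coroot H (\<phi> r) h \<longrightarrow>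
         \<phi> s h = complex_of_real (2 * (s \<bullet> r) / (r \<bullet> r)))"

definition structure_const :: "(real ^ 8 \<Rightarrow> 'l) \<Rightarrow> real ^ 8 \<Rightarrow> real ^ 8 \<Rightarrow> complex" where
  "structure_const e r s = (THE c. bracket (e r) (e s) = scale c (e (r + s)))"

definition basis_set :: "(real ^ 8 \<Rightarrow> 'l) \<Rightarrow> 'l set" where
  "basis_set e = (\<lambda>r. bracket (e r) (e (- r))) ` simple_roots \<union> e ` E6"

definition chevalley_basis ::
    "'l set \<Rightarrow> (real ^ 8 \<Rightarrow> 'l \<Rightarrow> complex) \<Rightarrow> (real ^ 8 \<Rightarrow> 'l) \<Rightarrow> bool" where
  "chevalley_basis H \<phi> e \<longleftrightarrow>
     independent (basis_set e) \<and> span (basis_set e) = UNIV \<and>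
     (\<forall>r\<in>E6. e r \<in> root_space H (\<phi> r)) \<and>
     (\<forall>r\<in>E6. is_coroot H (\<phi> r) (bracket (e r) (e (- r)))) \<and>
     (\<forall>r\<in>E6. \<forall>s\<in>E6. r + s \<in> E6 \<longrightarrow>
         structure_const e r s \<in> {1, -1} \<and>
         bracket (e r) (e s) = scale (structure_const e r s) (e (r + s)))"


section \<open>The Chevalley group over a field\<close>

text \<open>The \<open>\<int>\<close>-form of the Lie algebra is free on \<^term>\<open>basis_set e\<close>, so its extension of scalars
  to \<open>K\<close> is the space of \<open>K\<close>-valued (extensional) coordinate functions on that set.\<close>

definition lie_over :: "(real ^ 8 \<Rightarrow> 'l) \<Rightarrow> ('l \<Rightarrow> 'k::field) set" where
  "lie_over e = (basis_set e \<rightarrow>\<^sub>E UNIV)"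

text \<open>For a linear \<open>f\<close> preserving the \<open>\<int>\<close>-form, \<open>base_change e f\<close> is the \<open>K\<close>-linear map it induces:
  its matrix is that of \<open>f\<close>, with the integer entries read in \<open>K\<close>.\<close>

definition base_change ::
    "(real ^ 8 \<Rightarrow> 'l) \<Rightarrow> ('l \<Rightarrow> 'l) \<Rightarrow> ('l \<Rightarrow> 'k::field) \<Rightarrow> 'l \<Rightarrow> 'k" where
  "base_change e f v = (\<lambda>b \<in> basis_set e.
     \<Sum>b'\<in>basis_set e.
       of_int (THE m. complex_of_int m = representation (basis_set e) (f b') b) * v b')"

definition divided_power :: "'l \<Rightarrow> nat \<Rightarrow> 'l \<Rightarrow> 'l" where
  "divided_power x n y = scale (1 / fact n) ((bracket x ^^ n) y)"

text \<open>\<open>exp (t ad e\<^sub>r)\<close> over \<open>K\<close>: dividing by \<open>n!\<close> takes place before the extension of scalars.  The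
  sum ranges over the finitely many non-zero powers of \<open>ad e\<^sub>r\<close>.\<close>

definition root_elt ::
    "(real ^ 8 \<Rightarrow> 'l) \<Rightarrow> real ^ 8 \<Rightarrow> 'k::field \<Rightarrow> ('l \<Rightarrow> 'k) \<Rightarrow> ('l \<Rightarrow> 'k)" where
  "root_elt e r t = (\<lambda>v \<in> lie_over e. \<lambda>b \<in> basis_set e.
     \<Sum>n | \<exists>y. (bracket (e r) ^^ n) y \<noteq> 0.
       t ^ n * base_change e (divided_power (e r) n) v b)"

text \<open>The group operation is composition of maps, \<open>(g h) v = g (h v)\<close>.  The ambient group is
  that of all permutations of the Lie algebra over \<open>K\<close> instead of its Lie algebra automorphisms; the
  generated subgroup is the same.\<close>

definition chevalley_group ::
    "(real ^ 8 \<Rightarrow> 'l) \<Rightarrow> (('l \<Rightarrow> 'k::field) \<Rightarrow> ('l \<Rightarrow> 'k)) monoid" where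
  "chevalley_group e =
     subgroup_generated (BijGroup (lie_over e)) {root_elt e r t | r t. r \<in> E6}"

end

definition group_commutator :: "('a, 'b) monoid_scheme \<Rightarrow> 'a \<Rightarrow> 'a \<Rightarrow> 'a" where
  "group_commutator G x y = inv\<^bsub>G\<^esub> x \<otimes>\<^bsub>G\<^esub> inv\<^bsub>G\<^esub> y \<otimes>\<^bsub>G\<^esub> x \<otimes>\<^bsub>G\<^esub> y"

end

theory Submission
  imports Defs
begin

text \<open>The structure constants satisfy \<open>N\<^bsub>s,r\<^esub> = -N\<^bsub>r,s\<^esub>\<close>, \<open>N\<^bsub>-r,-s\<^esub> = -N\<^bsub>r,s\<^esub>\<close>, are invariant
  under cyclic permutations of triples with \<open>r + s + t = 0\<close>, and, by the Jacobi identity, satisfy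
  \<open>N\<^bsub>a,b\<^esub> N\<^bsub>a+b,c\<^esub> = N\<^bsub>b,c\<^esub> N\<^bsub>a,b+c\<^esub>\<close> whenever \<open>a\<close> is orthogonal to \<open>c\<close>.  If \<open>(\<alpha>, s)\<close> is the extraspecial
  pair with sum \<open>p + q\<close> and \<open>p \<noteq> \<alpha>\<close>, then \<open>\<alpha>\<close> is simple, orthogonal to one of \<open>p\<close>, \<open>q\<close>, and can be
  subtracted from the other one.  This expresses \<open>N\<^bsub>p,q\<^esub>\<close> by two constants of smaller height, so all signs follow
  from those of the extraspecial pairs.

  For roots with \<open>r + s\<close> a root put \<open>X = ad e\<^sub>r\<close>, \<open>Y = ad e\<^sub>s\<close>, \<open>Z = ad e\<^bsub>r+s\<^esub>\<close>.  All their
  cubes vanish, \<open>XY = YX + N Z\<close>, and \<open>Z\<close> commutes with \<open>X\<close> and \<open>Y\<close>.  In characteristic zero this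
  gives finitely many identities between integral operators and divided squares, which survive the
  extension of scalars and amount to
  \<open>x\<^sub>r(u) x\<^sub>s(t) = x\<^sub>s(t) x\<^sub>r(u) x\<^bsub>r+s\<^esub>(N t u)\<close>.\<close>

section \<open>Roots as integer coefficient lists\<close>

text \<open>Coefficients are listed in the order \<open>f, e, b, d, c, a\<close>, so that \<^const>\<open>prec\<close> becomes the
  lexicographic order.\<close>

definition root_comb :: "int list \<Rightarrow> real ^ 8" where
  "root_comb x = of_int (x ! 0) *\<^sub>R rf + of_int (x ! 1) *\<^sub>R re + of_int (x ! 2) *\<^sub>R rb +
     of_int (x ! 3) *\<^sub>R rd + of_int (x ! 4) *\<^sub>R rc + of_int (x ! 5) *\<^sub>R ra"

definition pos_coeffs :: "int list list" where
  "pos_coeffs =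
  [[0,0,0,0,0,1], [0,0,0,0,1,0], [0,0,0,0,1,1], [0,0,0,1,0,0],
   [0,0,0,1,1,0], [0,0,0,1,1,1], [0,0,1,0,0,0], [0,0,1,1,0,0],
   [0,0,1,1,1,0], [0,0,1,1,1,1], [0,1,0,0,0,0], [0,1,0,1,0,0],
   [0,1,0,1,1,0], [0,1,0,1,1,1], [0,1,1,1,0,0], [0,1,1,1,1,0],
   [0,1,1,1,1,1], [0,1,1,2,1,0], [0,1,1,2,1,1], [0,1,1,2,2,1],
   [1,0,0,0,0,0], [1,1,0,0,0,0], [1,1,0,1,0,0], [1,1,0,1,1,0],
   [1,1,0,1,1,1], [1,1,1,1,0,0], [1,1,1,1,1,0], [1,1,1,1,1,1],
   [1,1,1,2,1,0], [1,1,1,2,1,1], [1,1,1,2,2,1], [1,2,1,2,1,0],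
   [1,2,1,2,1,1], [1,2,1,2,2,1], [1,2,1,3,2,1], [1,2,2,3,2,1]]"

text \<open>The index type is the integers modulo 8, where \<open>of_nat\<close> is injective on the
  range \<open>1\<close> to \<open>8\<close> only. The bounds reduce the claim to comparing eight
  distinct residues.\<close>

lemma eps_inner [simp]:
  assumes "i \<in> {1..8}" "j \<in> {1..8}"
  shows "eps i \<bullet> eps j = (if i = j then 1 else 0)"
proof -
  have "i \<in> {1, 2, 3, 4, 5, 6, 7, 8}" "j \<in> {1, 2, 3, 4, 5, 6, 7, 8}"
    using assms unfolding atLeastAtMost_iff by auto
  then have "(of_nat i :: 8) = of_nat j \<longleftrightarrow> i = j"
    by (elim insertE emptyE; simp)
  then show ?thesis by (simp add: eps_def inner_axis_axis)
qed

section \<open>Comparison of the coefficient lists with the definition of \<open>E6\<close>\<close>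

lemma root_comb_Cons: "root_comb [f, e, b, d, c, a] =
    of_int f *\<^sub>R rf + of_int e *\<^sub>R re + of_int b *\<^sub>R rb + of_int d *\<^sub>R rd + of_int c *\<^sub>R rc + of_int a *\<^sub>R ra"
  by (simp add: root_comb_def)

text \<open>Coordinates with respect to the \<^const>\<open>eps\<close> are doubled to make them integers.\<close>

definition of_coords :: "int list \<Rightarrow> real ^ 8" where
  "of_coords ws = (1/2) *\<^sub>R (\<Sum>i = 1..8. of_int (ws ! (i - 1)) *\<^sub>R eps i)"

text \<open>The change of basis from the simple roots to doubled \<open>eps\<close> coordinates,
  read off from the definitions of \<open>ra\<close>, ..., \<open>rf\<close>. Lists of any other
  length get a dummy value.\<close>

fun coords :: "int list \<Rightarrow> int list" where
  "coords [f, e, b, d, c, a] =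
     [a + 2*b - 2*c, 2*b + 2*c - 2*d - a, 2*d - 2*e - a, 2*e - 2*f - a, 2*f - a, -a, -a, a]"
| "coords _ = []"

lemma sum_upto_5: "(\<Sum>i = 1..5::nat. f i) = f 1 + f 2 + f 3 + f 4 + f 5"
  for f :: "nat \<Rightarrow> 'a::comm_monoid_add"
  by (simp add: numeral_eq_Suc atLeastAtMostSuc_conv ac_simps)

lemma sum_upto_8: "(\<Sum>i = 1..8::nat. f i) = f 1 + f 2 + f 3 + f 4 + f 5 + f 6 + f 7 + f 8"
  for f :: "nat \<Rightarrow> 'a::comm_monoid_add"
  by (simp add: numeral_eq_Suc atLeastAtMostSuc_conv ac_simps)

lemma of_coords_coords: "of_coords (coords [f, e, b, d, c, a]) = root_comb [f, e, b, d, c, a]"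
  unfolding of_coords_def sum_upto_8 root_comb_Cons ra_def rb_def rc_def rd_def re_def rf_def
  by (simp add: scaleR_left_diff_distrib scaleR_diff_right scaleR_add_right scaleR_add_left)

text \<open>The two families in the definition of \<open>E6\<close> in executable form: 40 vectors
  with two non-zero doubled coordinates, and 32 vectors all of whose doubled coordinates are
  signs.\<close>

definition E6_coords :: "int list list" where
  "E6_coords =
     [map (\<lambda>k. if k = i then 2 * s else if k = j then 2 * t else 0) [1..<9].
        i \<leftarrow> [1..<6], j \<leftarrow> [i + 1..<6], s \<leftarrow> [1, -1], t \<leftarrow> [1, -1]] @
     [map ((*) s) (map (\<lambda>k. (-1) ^ k) n @ [-1, -1, 1]).
        s \<leftarrow> [1, -1], n \<leftarrow> List.n_lists 5 [0, 1], even (sum_list n :: nat)]"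

text \<open>A finite comparison of two sets of 72 integer vectors. It certifies that
  \<open>pos_coeffs\<close> together with its negatives misses no root and contains nothing
  else.\<close>

lemma E6_coords_eq: "set E6_coords = coords ` (set pos_coeffs \<union> map uminus ` set pos_coeffs)"
  by code_simp

lemma set_pair_comprehension: "set [f i j s t. i \<leftarrow> [1..<6], j \<leftarrow> [i + 1..<6], s \<leftarrow> [1, -1], t \<leftarrow> [1, -1]] =
   {f i j s t | i j s t. 1 \<le> i \<and> i < j \<and> j \<le> 5 \<and> s \<in> {1, -1} \<and> t \<in> {1, -1}}"
  for f :: "nat \<Rightarrow> nat \<Rightarrow> int \<Rightarrow> int \<Rightarrow> 'a"
proof -
  have "{1..<6} = {i. 1 \<le> i \<and> i \<le> (5::nat)}" "\<And>i. {i + 1..<6} = {j. i < j \<and> j \<le> (5::nat)}" by auto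
  then show ?thesis
    unfolding set_concat set_map set_upt image_image UN_simps by (simp only: list.simps set_concat set_map set_upt) fastforce
qed
lemma set_sign_comprehension: "set [f s n. s \<leftarrow> [1, -1], n \<leftarrow> N, even (sum_list n :: nat)] =
   {f s n | s n. s \<in> {1, -1} \<and> n \<in> set N \<and> even (sum_list n)}"
  for f :: "int \<Rightarrow> nat list \<Rightarrow> 'a"
  by auto

text \<open>The two families are matched separately. Real signs become integer signs, and the
  exponent function \<open>\<nu>\<close> becomes the list of its five relevant values.\<close>

lemma E6_coords_eq_E6: "E6 = of_coords ` set E6_coords"
proof -
  have *: "of_coords (map (\<lambda>k. if k = i then 2 * s else if k = j then 2 * t else 0) [1..<9])
      = of_int s *\<^sub>R eps i + of_int t *\<^sub>R eps j" (is "of_coords ?l = _")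
    if "1 \<le> i" "i < j" "j \<le> 5" for i j s t
  proof -
    have "(\<Sum>k = 1..8. of_int (?l ! (k - 1)) *\<^sub>R eps k) =
        (\<Sum>k = 1..8. (if k = i then (2 * of_int s) *\<^sub>R eps k else 0) + (if k = j then (2 * of_int t) *\<^sub>R eps k else 0))"
      using that by (intro sum.cong) auto
    also have "\<dots> = (2 * of_int s) *\<^sub>R eps i + (2 * of_int t) *\<^sub>R eps j"
      using that by (simp add: sum.distrib)
    finally show ?thesis
      by (simp add: of_coords_def scaleR_add_right)
  qed
  have **: "of_coords (map ((*) s) (map (\<lambda>k. (-1) ^ k) n @ [-1, -1, 1])) =
     of_int s *\<^sub>R (1/2) *\<^sub>R (eps 8 - eps 7 - eps 6 + (\<Sum>i = 1..5. (-1) ^ (n ! (i - 1)) *\<^sub>R eps i))"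
    if "length n = 5" for s and n :: "nat list"
  proof -
    from that obtain a b c d e where n: "n = [a,b,c,d,e]"
      by (auto simp: numeral_eq_Suc length_Suc_conv)
    show ?thesis
      unfolding of_coords_def sum_upto_8 sum_upto_5 n
      by (simp add: scaleR_add_right scaleR_diff_right algebra_simps)
  qed
  have 1: "{\<sigma> *\<^sub>R eps i + \<tau> *\<^sub>R eps j | \<sigma> \<tau> i j.
            \<sigma> \<in> {1, -1} \<and> \<tau> \<in> {1, -1} \<and> 1 \<le> i \<and> i < j \<and> j \<le> 5} =
     of_coords ` {map (\<lambda>k. if k = i then 2 * s else if k = j then 2 * t else 0) [1..<9] | i j s t.
         1 \<le> i \<and> i < j \<and> j \<le> 5 \<and> s \<in> {1, -1} \<and> t \<in> {1, -1}}" (is "?A = of_coords ` ?B")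
  proof (intro equalityI subsetI)
    fix v assume "v \<in> ?A"
    then obtain \<sigma> \<tau> i j where v: "v = \<sigma> *\<^sub>R eps i + \<tau> *\<^sub>R eps j" "\<sigma> \<in> {1, -1}" "\<tau> \<in> {1, -1}"
       and ij: "1 \<le> i" "i < j" "j \<le> 5" by blast
    obtain s t :: int where "s \<in> {1, -1}" "t \<in> {1, -1}" "\<sigma> = of_int s" "\<tau> = of_int t"
      using v(2,3) by (metis insertE insertCI empty_iff of_int_1 of_int_minus)
    then have "v = of_coords (map (\<lambda>k. if k = i then 2 * s else if k = j then 2 * t else 0) [1..<9])"
      using *[OF ij, of s t] v(1) by simp
    with ij \<open>s \<in> _\<close> \<open>t \<in> _\<close> show "v \<in> of_coords ` ?B" by blast
  next
    fix v assume "v \<in> of_coords ` ?B"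
    then obtain i j s t where v: "v = of_coords (map (\<lambda>k. if k = i then 2 * s else if k = j then 2 * t else 0) [1..<9])"
       "1 \<le> i" "i < j" "j \<le> 5" "s \<in> {1, -1}" "t \<in> {1, -1}" by blast
    then have "v = of_int s *\<^sub>R eps i + of_int t *\<^sub>R eps j" using * by simp
    moreover have "(of_int s :: real) \<in> {1, -1}" "(of_int t :: real) \<in> {1, -1}" using v by auto
    ultimately show "v \<in> ?A" using v by blast
  qed
  have 2: "{\<sigma> *\<^sub>R (1/2) *\<^sub>R (eps 8 - eps 7 - eps 6 + (\<Sum>i = 1..5. (-1) ^ \<nu> i *\<^sub>R eps i)) | \<sigma> \<nu>.
            \<sigma> \<in> {1, -1} \<and> (\<forall>i\<in>{1..5}. \<nu> i \<in> {0, 1 :: nat}) \<and> even (\<Sum>i = 1..5. \<nu> i)} =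
     of_coords ` {map ((*) s) (map (\<lambda>k. (-1) ^ k) n @ [-1, -1, 1]) | s n.
         s \<in> {1, -1} \<and> n \<in> set (List.n_lists 5 [0, 1]) \<and> even (sum_list n)}" (is "?A = of_coords ` ?B")
  proof (intro equalityI subsetI)
    fix v assume "v \<in> ?A"
    then obtain \<sigma> \<nu> where v: "v = \<sigma> *\<^sub>R (1/2) *\<^sub>R (eps 8 - eps 7 - eps 6 + (\<Sum>i = 1..5. (-1) ^ \<nu> i *\<^sub>R eps i))"
       "\<sigma> \<in> {1, -1}" "\<forall>i\<in>{1..5}. \<nu> i \<in> {0, 1 :: nat}" "even (\<Sum>i = 1..5. \<nu> i)" by blast
    obtain s :: int where s: "s \<in> {1, -1}" "\<sigma> = of_int s"
      using v(2) by (metis insertE insertCI empty_iff of_int_1 of_int_minus)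
    define n where "n = [\<nu> 1, \<nu> 2, \<nu> 3, \<nu> 4, \<nu> 5]"
    have n: "n \<in> set (List.n_lists 5 [0, 1])" "even (sum_list n)"
      using v(3,4) unfolding sum_upto_5 by (auto simp: n_def set_n_lists)
    have "v = of_coords (map ((*) s) (map (\<lambda>k. (-1) ^ k) n @ [-1, -1, 1]))"
      unfolding v(1) s(2) by (subst **) (simp add: n_def, unfold n_def sum_upto_5, simp)
    with s n show "v \<in> of_coords ` ?B" by blast
  next
    fix v assume "v \<in> of_coords ` ?B"
    then obtain s n where v: "v = of_coords (map ((*) s) (map (\<lambda>k. (-1) ^ k) n @ [-1, -1, 1]))"
       "s \<in> {1, -1}" "length n = 5" "set n \<subseteq> {0, 1}" "even (sum_list n)" by (auto simp: set_n_lists)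
    have "of_int s \<in> {1, -1::real}" using v by auto
    moreover have "\<forall>i\<in>{1..5}. n ! (i - 1) \<in> {0, 1 :: nat}" using v(3,4)
      by
        (metis Suc_le_eq Suc_pred' atLeastAtMost_iff lessI nth_mem order_less_le_trans subsetD
          zero_less_one le_less_trans One_nat_def)
    moreover have "even (\<Sum>i = 1..5. n ! (i - 1))"
      using v(5,3) unfolding sum_upto_5 by (auto simp: numeral_eq_Suc length_Suc_conv add.assoc)
    ultimately show "v \<in> ?A" unfolding v(1) **[OF v(3)]
      by (intro CollectI exI[of _ "of_int s"] exI[of _ "\<lambda>i. n ! (i - 1)"] conjI refl)
  qed
  show ?thesis
    unfolding E6_def 1 2 E6_coords_def set_append set_pair_comprehension set_sign_comprehension image_Un ..
qed

lemma root_comb_uminus: "root_comb (map uminus x) = - root_comb x" if "length x = 6"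
  using that by (simp add: root_comb_def)

lemma root_comb_add: "root_comb (map2 (+) x y) = root_comb x + root_comb y" if "length x = 6" "length y = 6"
  using that by (simp add: root_comb_def scaleR_add_left)

lemma length_pos_coeffs: "x \<in> set pos_coeffs \<Longrightarrow> length x = 6"
  by (auto simp: pos_coeffs_def)

lemma length_6D: "length x = 6 \<Longrightarrow> \<exists>f e b d c a. x = [f, e, b, d, c, a]"
  by (auto simp: numeral_eq_Suc length_Suc_conv)

lemma E6_eq: "E6 = root_comb ` (set pos_coeffs \<union> map uminus ` set pos_coeffs)"
proof -
  have "of_coords (coords x) = root_comb x" if "x \<in> set pos_coeffs \<union> map uminus ` set pos_coeffs" for x
  proof -
    have "length x = 6" using that by (auto simp: length_pos_coeffs)
    then show ?thesis using length_6D of_coords_coords by blast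
  qed
  then show ?thesis
    unfolding E6_coords_eq_E6 E6_coords_eq image_image by (intro image_cong) auto
qed

section \<open>The inner product and the order on coefficient lists\<close>

definition cartan_form :: "int list \<Rightarrow> int list \<Rightarrow> int" where
  "cartan_form x y = x ! 0 * (2 * y ! 0 - y ! 1) + x ! 1 * (2 * y ! 1 - y ! 0 - y ! 3) +
     x ! 2 * (2 * y ! 2 - y ! 3) + x ! 3 * (2 * y ! 3 - y ! 1 - y ! 2 - y ! 4) +
     x ! 4 * (2 * y ! 4 - y ! 3 - y ! 5) + x ! 5 * (2 * y ! 5 - y ! 4)"

lemma simple_inner:
  "ra \<bullet> ra = 2" "rb \<bullet> rb = 2" "rc \<bullet> rc = 2" "rd \<bullet> rd = 2" "re \<bullet> re = 2" "rf \<bullet> rf = 2"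
  "ra \<bullet> rc = -1" "rc \<bullet> ra = -1" "rc \<bullet> rd = -1" "rd \<bullet> rc = -1" "rd \<bullet> re = -1" "re \<bullet> rd = -1"
  "re \<bullet> rf = -1" "rf \<bullet> re = -1" "rb \<bullet> rd = -1" "rd \<bullet> rb = -1"
  "ra \<bullet> rb = 0" "rb \<bullet> ra = 0" "ra \<bullet> rd = 0" "rd \<bullet> ra = 0" "ra \<bullet> re = 0" "re \<bullet> ra = 0"
  "ra \<bullet> rf = 0" "rf \<bullet> ra = 0" "rb \<bullet> rc = 0" "rc \<bullet> rb = 0" "rb \<bullet> re = 0" "re \<bullet> rb = 0"
  "rb \<bullet> rf = 0" "rf \<bullet> rb = 0" "rc \<bullet> re = 0" "re \<bullet> rc = 0" "rc \<bullet> rf = 0" "rf \<bullet> rc = 0"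
  "rd \<bullet> rf = 0" "rf \<bullet> rd = 0"
  by (simp_all add: ra_def rb_def rc_def rd_def re_def rf_def inner_add_left inner_add_right
      inner_diff_left inner_diff_right del: One_nat_def)

text \<open>\<open>cartan_form\<close> is the bilinear form of the Gram matrix of the simple roots.
  As all roots have squared length 2, its values on roots are also the Cartan integers.\<close>

lemma root_comb_inner: "root_comb x \<bullet> root_comb y = of_int (cartan_form x y)"
  by (simp add: root_comb_def cartan_form_def inner_add_left inner_add_right simple_inner algebra_simps)

text \<open>Pairing with \<open>eps 8\<close> isolates the coefficient of \<open>ra\<close>. Then
  \<open>eps 5\<close>, \<open>eps 4\<close> and \<open>eps 3\<close> give those of
  \<open>rf\<close>, \<open>re\<close> and \<open>rd\<close> in turn, and \<open>eps 1\<close> and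
  \<open>eps 2\<close> together give those of \<open>rb\<close> and \<open>rc\<close>.\<close>

lemma simple_independent:
  assumes "f *\<^sub>R rf + e *\<^sub>R re + b *\<^sub>R rb + d *\<^sub>R rd + c *\<^sub>R rc + a *\<^sub>R ra = 0" (is "?v = 0")
  shows "f = 0 \<and> e = 0 \<and> b = 0 \<and> d = 0 \<and> c = 0 \<and> a = 0"
proof -
  have "?v \<bullet> eps i = 0" for i using assms by simp
  from this[of 1] this[of 2] this[of 3] this[of 4] this[of 5] this[of 8] show ?thesis
    by (simp add: ra_def rb_def rc_def rd_def re_def rf_def inner_add_left
      inner_diff_left del: One_nat_def)
qed

lemma root_comb_inj:
  assumes "root_comb x = root_comb y" "length x = 6" "length y = 6"
  shows "x = y"
proof -
  from length_6D[OF assms(2)] length_6D[OF assms(3)] obtain f e b d c a f' e' b' d' c' a'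
    where xy: "x = [f, e, b, d, c, a]" "y = [f', e', b', d', c', a']" by blast
  have "of_int (f - f') *\<^sub>R rf + of_int (e - e') *\<^sub>R re + of_int (b - b') *\<^sub>R rb +
     of_int (d - d') *\<^sub>R rd + of_int (c - c') *\<^sub>R rc + of_int (a - a') *\<^sub>R ra = 0"
    using assms(1) by (simp add: xy root_comb_Cons algebra_simps)
  from simple_independent[OF this] show ?thesis by (simp add: xy)
qed

text \<open>By linear independence the coefficients \<tau> in \<open>prec\<close> can only be the
  differences of the list entries. Positivity of the first non-zero difference is the lexicographic
  order.\<close>

lemma prec_iff_lexordp:
  assumes "length x = 6" "length y = 6"
  shows "prec (root_comb x) (root_comb y) \<longleftrightarrow> ord_class.lexordp x y"
proof -
  from length_6D[OF assms(1)] length_6D[OF assms(2)] obtain f e b d c a f' e' b' d' c' a'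
    where xy: "x = [f, e, b, d, c, a]" "y = [f', e', b', d', c', a']" by blast
  have lex: "(\<exists>k\<in>{1..6}. 0 < \<tau> k \<and> (\<forall>j\<in>{1..<k}. \<tau> j = 0)) \<longleftrightarrow>
      (0 < \<tau> 1 \<or> \<tau> 1 = 0 \<and> (0 < \<tau> 2 \<or> \<tau> 2 = 0 \<and> (0 < \<tau> 3 \<or> \<tau> 3 = 0 \<and> (0 < \<tau> 4 \<or> \<tau> 4 = 0 \<and>
      (0 < \<tau> 5 \<or> \<tau> 5 = 0 \<and> 0 < \<tau> 6)))))" for \<tau> :: "nat \<Rightarrow> real"
  proof -
    have s: "{1..6::nat} = {1,2,3,4,5,6}" "{1..<1::nat} = {}" "{1..<2::nat} = {1}" "{1..<3::nat} = {1,2}"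
      "{1..<4::nat} = {1,2,3}" "{1..<5::nat} = {1,2,3,4}" "{1..<6::nat} = {1,2,3,4,5}"
      by (auto simp del: One_nat_def)
    show ?thesis unfolding s(1) bex_simps ball_simps s(2-) by (auto simp add: s(2-) simp del: One_nat_def)
  qed
  have eq: "root_comb y - root_comb x = \<tau> 1 *\<^sub>R rf + \<tau> 2 *\<^sub>R re + \<tau> 3 *\<^sub>R rb + \<tau> 4 *\<^sub>R rd + \<tau> 5 *\<^sub>R rc + \<tau> 6 *\<^sub>R ra
     \<longleftrightarrow> \<tau> 1 = of_int (f' - f) \<and> \<tau> 2 = of_int (e' - e) \<and> \<tau> 3 = of_int (b' - b) \<and> \<tau> 4 = of_int (d' - d)
        \<and> \<tau> 5 = of_int (c' - c) \<and> \<tau> 6 = of_int (a' - a)" (is "?l \<longleftrightarrow> ?r") for \<tau> :: "nat \<Rightarrow> real"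
  proof
    assume ?l
    then have "(of_int (f' - f) - \<tau> 1) *\<^sub>R rf + (of_int (e' - e) - \<tau> 2) *\<^sub>R re + (of_int (b' - b) - \<tau> 3) *\<^sub>R rb +
       (of_int (d' - d) - \<tau> 4) *\<^sub>R rd + (of_int (c' - c) - \<tau> 5) *\<^sub>R rc + (of_int (a' - a) - \<tau> 6) *\<^sub>R ra = 0"
      by (simp add: xy root_comb_Cons algebra_simps)
    from simple_independent[OF this] show ?r by simp
  next
    assume ?r
    then show ?l
      by (elim conjE) (simp only: xy root_comb_Cons of_int_diff scaleR_left_diff_distrib, simp)
  qed
  show ?thesis
  proof
    assume "prec (root_comb x) (root_comb y)"
    then obtain \<tau> :: "nat \<Rightarrow> real" where \<tau>:
      "root_comb y - root_comb x = \<tau> 1 *\<^sub>R rf + \<tau> 2 *\<^sub>R re + \<tau> 3 *\<^sub>R rb + \<tau> 4 *\<^sub>R rd + \<tau> 5 *\<^sub>R rc + \<tau> 6 *\<^sub>R ra"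
      "\<exists>k\<in>{1..6}. 0 < \<tau> k \<and> (\<forall>j\<in>{1..<k}. \<tau> j = 0)"
      unfolding prec_def by blast
    from \<tau>(2)[unfolded lex] \<tau>(1)[unfolded eq] show "ord_class.lexordp x y"
      by (auto simp: xy)
  next
    assume *: "ord_class.lexordp x y"
    let ?\<tau> = "\<lambda>k::nat. of_int (y ! (k - 1) - x ! (k - 1)) :: real"
    show "prec (root_comb x) (root_comb y)"
      unfolding prec_def
      by (rule exI[of _ ?\<tau>], rule conjI, subst eq, simp add: xy, subst lex, use * in \<open>auto simp: xy\<close>)
  qed
qed

section \<open>The signs are determined by the extraspecial pairs\<close>

text \<open>Listed in increasing order, so that \<open>hd\<close> in \<open>first_simple\<close>
  selects the smallest simple root that can be subtracted.\<close>

definition simple_coeffs :: "int list list" where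
  "simple_coeffs = [[0,0,0,0,0,1], [0,0,0,0,1,0], [0,0,0,1,0,0], [0,0,1,0,0,0], [0,1,0,0,0,0], [1,0,0,0,0,0]]"

definition exceptional_coeffs :: "(int list \<times> int list) list" where
  "exceptional_coeffs =
  [([0,0,0,0,1,1], [0,1,1,2,1,0]), ([0,0,0,0,1,1], [1,1,1,2,1,0]), ([0,0,0,0,1,1], [1,2,1,2,1,0]),
   ([0,0,0,1,1,0], [0,1,1,1,0,0]), ([0,0,0,1,1,0], [1,1,1,1,0,0]), ([0,0,0,1,1,0], [1,2,1,2,1,1]),
   ([0,0,0,1,1,1], [0,1,1,1,0,0]), ([0,0,0,1,1,1], [0,1,1,1,1,0]), ([0,0,0,1,1,1], [1,1,1,1,0,0]),
   ([0,0,0,1,1,1], [1,1,1,1,1,0]), ([0,0,1,1,0,0], [0,1,0,0,0,0]), ([0,0,1,1,0,0], [1,1,0,0,0,0]),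
   ([0,0,1,1,0,0], [1,2,1,2,2,1]), ([0,0,1,1,1,0], [0,1,0,0,0,0]), ([0,0,1,1,1,0], [0,1,0,1,0,0]),
   ([0,0,1,1,1,0], [1,1,0,0,0,0]), ([0,0,1,1,1,0], [1,1,0,1,0,0]), ([0,0,1,1,1,1], [0,1,0,0,0,0]),
   ([0,0,1,1,1,1], [0,1,0,1,0,0]), ([0,0,1,1,1,1], [0,1,0,1,1,0]), ([0,0,1,1,1,1], [1,1,0,0,0,0]),
   ([0,0,1,1,1,1], [1,1,0,1,0,0]), ([0,0,1,1,1,1], [1,1,0,1,1,0]), ([0,0,1,1,1,1], [1,2,1,2,1,0]),
   ([0,1,0,1,0,0], [1,1,1,1,1,0]), ([0,1,0,1,0,0], [1,1,1,1,1,1]), ([0,1,0,1,1,0], [1,1,1,1,1,1]),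
   ([0,1,0,1,1,0], [1,1,1,2,1,1]), ([0,1,1,1,1,0], [1,1,0,1,0,0]), ([0,1,1,1,1,0], [1,1,1,2,1,1]),
   ([0,1,1,1,1,1], [1,1,0,1,0,0]), ([0,1,1,1,1,1], [1,1,0,1,1,0]), ([0,1,1,2,1,1], [1,1,0,1,1,0]),
   ([0,1,1,2,1,1], [1,1,1,1,1,0])]"

lemma cartan_form_code [code]:
  "cartan_form [f, e, b, d, c, a] [f', e', b', d', c', a'] =
    f * (2 * f' - e') + e * (2 * e' - f' - d') + b * (2 * b' - d') + d * (2 * d' - e' - b' - c') +
     c * (2 * c' - d' - a') + a * (2 * a' - c')"
  by (simp add: cartan_form_def)

text \<open>The first component of the extraspecial pair with sum \<open>r\<close>.\<close>

definition first_simple :: "int list \<Rightarrow> int list" where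
  "first_simple r = hd [x \<leftarrow> simple_coeffs. cartan_form r x = 1]"

definition eta_coeffs :: "int list \<Rightarrow> int list \<Rightarrow> int" where
  "eta_coeffs p q = (if (p, q) \<in> set exceptional_coeffs then -1 else 1)"

text \<open>The smaller pairs met in the recursion come in either order, so the signs are extended
  by antisymmetry.\<close>

definition sgn_coeffs :: "int list \<Rightarrow> int list \<Rightarrow> int" where
  "sgn_coeffs p q = (if ord_class.lexordp p q then eta_coeffs p q else - eta_coeffs q p)"

lemma pos_coeffs_check:
  "\<forall>r \<in> set pos_coeffs. cartan_form r r = 2 \<and> 0 < sum_list r \<and> ord_class.lexordp [0,0,0,0,0,0] r"
  by code_simp

text \<open>The last clause serves minimality: the first member of any special pair with sum
  \<open>r\<close> has inner product 1 with \<open>r\<close>, so it is among the \<open>x\<close>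
  compared with \<alpha>.\<close>

lemma first_simple_check:
  "\<forall>r \<in> set pos_coeffs. r \<in> set simple_coeffs \<or>
     (let \<alpha> = first_simple r; s = map2 (-) r \<alpha> in \<alpha> \<in> set simple_coeffs \<and> s \<in> set pos_coeffs \<and> ord_class.lexordp \<alpha> s \<and>
       (\<forall>x \<in> set pos_coeffs. ord_class.lexordp \<alpha> x \<or> x = \<alpha> \<or> cartan_form r x \<noteq> 1))"
  by code_simp

text \<open>Disjunctions replace implications here because \<open>code_simp\<close> evaluates only the former lazily.\<close>

lemma eta_check:
  "\<forall>p \<in> set pos_coeffs. \<forall>q \<in> set pos_coeffs. \<not> ord_class.lexordp p q \<or> cartan_form p q \<noteq> -1 \<or>
     (let \<alpha> = first_simple (map2 (+) p q) in
        p = \<alpha> \<and> eta_coeffs p q = 1 \<or>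
        cartan_form \<alpha> p = 1 \<and> (let \<delta> = map2 (-) p \<alpha> in \<delta> \<in> set pos_coeffs \<and>
           sgn_coeffs \<alpha> \<delta> * sgn_coeffs \<delta> q = eta_coeffs p q) \<or>
        cartan_form \<alpha> q = 1 \<and> (let \<delta> = map2 (-) q \<alpha> in \<delta> \<in> set pos_coeffs \<and>
           sgn_coeffs \<alpha> \<delta> * sgn_coeffs p \<delta> = eta_coeffs p q))"
  by code_simp

section \<open>Passing between roots and coefficient lists\<close>

lemma simple_coeffs_subset: "set simple_coeffs \<subseteq> set pos_coeffs"
  by (auto simp: simple_coeffs_def pos_coeffs_def)

lemma root_comb_zero: "root_comb [0,0,0,0,0,0] = 0"
  by (simp add: root_comb_def)

lemma root_comb_diff: "root_comb (map2 (-) x y) = root_comb x - root_comb y" if "length x = 6" "length y = 6"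
  using that by (simp add: root_comb_def scaleR_left_diff_distrib)

lemma root_comb_pos_in_E6: "x \<in> set pos_coeffs \<Longrightarrow> root_comb x \<in> E6"
  by (auto simp: E6_eq)

lemma positive_roots_eq: "positive_roots = root_comb ` set pos_coeffs"
proof -
  have pos: "prec 0 (root_comb x)" if "x \<in> set pos_coeffs" for x
    using prec_iff_lexordp[of "[0,0,0,0,0,0]" x] pos_coeffs_check[rule_format, OF that] that
    by (simp add: root_comb_zero length_pos_coeffs)
  have neg: "\<not> prec 0 (root_comb (map uminus x))" if "x \<in> set pos_coeffs" for x
  proof -
    have "ord_class.lexordp [0,0,0,0,0,0] x" using pos_coeffs_check[rule_format, OF that] by simp
    moreover obtain f e b d c a where "x = [f, e, b, d, c, a]"
      using length_6D[OF length_pos_coeffs[OF \<open>x \<in> set pos_coeffs\<close>]] by blast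
    ultimately have "\<not> ord_class.lexordp [0,0,0,0,0,0] (map uminus x)" by auto
    then show ?thesis
      using prec_iff_lexordp[of "[0,0,0,0,0,0]" "map uminus x"] that
      by (simp add: root_comb_zero length_pos_coeffs)
  qed
  show ?thesis unfolding positive_roots_def E6_eq using pos neg by blast
qed

lemma E6_pos_cases:
  assumes "r \<in> E6"
  obtains x where "x \<in> set pos_coeffs" "r = root_comb x"
    | x where "x \<in> set pos_coeffs" "r = - root_comb x"
  using assms unfolding E6_eq by (blast intro: root_comb_uminus[OF length_pos_coeffs])

lemma E6_uminus:
  assumes "r \<in> E6"
  shows "- r \<in> E6"
proof -
  have neg: "- root_comb x \<in> E6" if "x \<in> set pos_coeffs" for x
    unfolding E6_eq root_comb_uminus[OF length_pos_coeffs[OF that], symmetric] using that by blast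
  from assms show ?thesis by (cases rule: E6_pos_cases) (simp_all add: neg root_comb_pos_in_E6)
qed

lemma E6_cases:
  assumes "r \<in> E6"
  obtains x where "length x = 6" "r = root_comb x"
  proof -
  from assms obtain x where x: "x \<in> set pos_coeffs \<union> map uminus ` set pos_coeffs" "r = root_comb x"
    by (auto simp: E6_eq)
  moreover from x(1) have "length x = 6" by (auto simp: length_pos_coeffs)
  ultimately show thesis using that by blast
qed

lemma E6_inner_self: "r \<bullet> r = 2" if "r \<in> E6"
proof -
  have pos: "root_comb x \<bullet> root_comb x = 2" if "x \<in> set pos_coeffs" for x
    using pos_coeffs_check[rule_format, OF that] by (simp add: root_comb_inner)
  from \<open>r \<in> E6\<close> show ?thesis by (cases rule: E6_pos_cases) (simp_all add: pos)
qed

lemma E6_inner_Ints: "r \<bullet> s \<in> \<int>" if "r \<in> E6" "s \<in> E6"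
proof -
  from that obtain x y where "r = root_comb x" "s = root_comb y" by (elim E6_cases)
  then show ?thesis by (simp add: root_comb_inner)
qed

lemma E6_nonzero: "r \<noteq> 0" if "r \<in> E6"
  using E6_inner_self[OF that] by auto

text \<open>Expand the squared length of \<open>r + s\<close>; all three squared lengths are
  2.\<close>

lemma E6_add_imp_inner: "r \<bullet> s = -1" if "r \<in> E6" "s \<in> E6" "r + s \<in> E6"
  using E6_inner_self[OF that(1)] E6_inner_self[OF that(2)] E6_inner_self[OF that(3)]
  by (simp add: inner_add_left inner_add_right inner_commute)

text \<open>Positive height rules out the negative of a listed root.\<close>

lemma mem_pos_coeffs_iff:
  assumes "length x = 6" "0 < sum_list x"
  shows "root_comb x \<in> E6 \<longleftrightarrow> x \<in> set pos_coeffs"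
proof
  assume "root_comb x \<in> E6"
  then obtain y where y: "y \<in> set pos_coeffs" "root_comb x = root_comb y \<or> root_comb x = root_comb (map uminus y)"
    unfolding E6_eq by blast
  have "length y = 6" using y(1) by (rule length_pos_coeffs)
  with y(2) assms(1) have "x = y \<or> x = map uminus y"
    using root_comb_inj[of x y] root_comb_inj[of x "map uminus y"] by auto
  moreover have "x \<noteq> map uminus y"
  proof
    assume "x = map uminus y"
    moreover have "sum_list (map uminus y) = - sum_list y" by (induction y) simp_all
    ultimately show False using pos_coeffs_check[rule_format, OF y(1)] assms(2) by simp
  qed
  ultimately show "x \<in> set pos_coeffs" using y(1) by blast
qed (rule root_comb_pos_in_E6)

section \<open>Exceptional and extraspecial pairs in coefficients\<close>

lemma exceptional_pairs_eq:
  "exceptional_pairs = (\<lambda>(p, q). (root_comb p, root_comb q)) ` set exceptional_coeffs"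
proof -
  have *: "{x} \<times> insert y A = insert (x, y) ({x} \<times> A)" "{x} \<times> {} = {}" for x y :: "real ^ 8" and A by auto
  \<comment> \<open>Both sides enumerate the 34 pairs in the same order, so it is enough to drop
    zero coefficients and normalise the sums.\<close>
  show ?thesis
    by (simp only: exceptional_pairs_def Let_def exceptional_coeffs_def list.set image_insert image_empty prod.case
        root_comb_Cons of_int_0 of_int_1 of_int_numeral scaleR_zero_left scaleR_one add_0_left add_0_right
        * Un_insert_left Un_empty_left add.assoc add.commute add.left_commute)
qed

lemma eta_root_comb:
  assumes "length p = 6" "length q = 6"
  shows "eta (root_comb p) (root_comb q) = (of_int (eta_coeffs p q) :: 'k::field)"
proof -
  have len: "\<forall>(p, q) \<in> set exceptional_coeffs. length p = 6 \<and> length q = 6"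
    by (simp add: exceptional_coeffs_def)
  have "(root_comb p, root_comb q) \<in> exceptional_pairs \<longleftrightarrow> (p, q) \<in> set exceptional_coeffs"
  proof
    assume "(root_comb p, root_comb q) \<in> exceptional_pairs"
    then obtain p' q' where *: "(p', q') \<in> set exceptional_coeffs" "root_comb p = root_comb p'" "root_comb q = root_comb q'"
      unfolding exceptional_pairs_eq by force
    moreover from len *(1) have "length p' = 6" "length q' = 6" by blast+
    ultimately show "(p, q) \<in> set exceptional_coeffs" using assms root_comb_inj by metis
  next
    assume "(p, q) \<in> set exceptional_coeffs"
    then show "(root_comb p, root_comb q) \<in> exceptional_pairs"
      unfolding exceptional_pairs_eq by (rule rev_image_eqI) simp
  qed
  then show ?thesis by (simp add: eta_def eta_coeffs_def)
qed

text \<open>If a special pair \<open>(r1, s1)\<close> has this sum, then the inner product of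
  \<open>r1\<close> with the sum is \<open>2 - 1 = 1\<close>. Hence the finite check of minimality
  covers \<open>r1\<close>.\<close>

lemma extraspecial_first_simple:
  assumes r: "r \<in> set pos_coeffs" and nonsimple: "r \<notin> set simple_coeffs"
  shows "extraspecial (root_comb (first_simple r)) (root_comb (map2 (-) r (first_simple r)))"
proof -
  define \<alpha> s where "\<alpha> = first_simple r" and "s = map2 (-) r \<alpha>"
  have \<alpha>: "\<alpha> \<in> set pos_coeffs" and s: "s \<in> set pos_coeffs" and less: "ord_class.lexordp \<alpha> s"
    and least: "\<And>x. x \<in> set pos_coeffs \<Longrightarrow> cartan_form r x = 1 \<Longrightarrow> x = \<alpha> \<or> ord_class.lexordp \<alpha> x"
    using first_simple_check[rule_format, OF r] nonsimple simple_coeffs_subset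
    unfolding Let_def \<alpha>_def[symmetric] s_def[symmetric] by blast+
  have len: "length r = 6" "length \<alpha> = 6" "length s = 6"
    using r \<alpha> s by (simp_all add: length_pos_coeffs)
  have sum: "root_comb \<alpha> + root_comb s = root_comb r"
    using len by (simp add: s_def root_comb_diff)
  have "\<alpha> \<in> set pos_coeffs \<Longrightarrow> prec 0 (root_comb \<alpha>)"
    using positive_roots_eq unfolding positive_roots_def by blast
  then have "special (root_comb \<alpha>) (root_comb s)"
    unfolding special_def sum using \<alpha> s r less len
    by (simp add: root_comb_pos_in_E6 prec_iff_lexordp)
  moreover have "preceq (root_comb \<alpha>) r1" if "special r1 s1" "r1 + s1 = root_comb \<alpha> + root_comb s" for r1 s1
  proof -
    from that(1) have "r1 \<in> positive_roots" "s1 \<in> E6" "r1 \<in> E6" "r1 + s1 \<in> E6"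
      by (auto simp: special_def positive_roots_def)
    then obtain x where x: "x \<in> set pos_coeffs" "r1 = root_comb x"
      by (auto simp: positive_roots_eq)
    have "root_comb r \<bullet> r1 = 1"
      using E6_inner_self[OF \<open>r1 \<in> E6\<close>] E6_add_imp_inner[OF \<open>r1 \<in> E6\<close> \<open>s1 \<in> E6\<close> \<open>r1 + s1 \<in> E6\<close>]
      by (simp add: sum[symmetric] that(2)[symmetric] inner_add_left inner_add_right inner_commute)
    then have "cartan_form r x = 1" by (simp add: x root_comb_inner)
    then show ?thesis
      using least[OF x(1)] x len by (auto simp: preceq_def prec_iff_lexordp length_pos_coeffs)
  qed
  ultimately show ?thesis
    unfolding extraspecial_def \<alpha>_def[symmetric] s_def[symmetric] by blast
qed

section \<open>Induction on the height of the sum\<close>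

lemma list6_arith:
  fixes x y z :: "int list"
  assumes "length x = 6" "length y = 6" "length z = 6"
  shows "map2 (+) x (map2 (-) y x) = y"
    "map2 (+) (map2 (-) x z) y = map2 (-) (map2 (+) x y) z"
    "map2 (+) y (map2 (-) x z) = map2 (-) (map2 (+) y x) z"
    "map2 (+) x y = map2 (+) y x"
    "sum_list (map2 (+) x y) = sum_list x + sum_list y"
    "sum_list (map2 (-) x y) = sum_list x - sum_list y"
proof -
  from length_6D[OF assms(1)] obtain x1 x2 x3 x4 x5 x6 where x: "x = [x1, x2, x3, x4, x5, x6]" by blast
  from length_6D[OF assms(2)] obtain y1 y2 y3 y4 y5 y6 where y: "y = [y1, y2, y3, y4, y5, y6]" by blast
  from length_6D[OF assms(3)] obtain z1 z2 z3 z4 z5 z6 where z: "z = [z1, z2, z3, z4, z5, z6]" by blast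
  show "map2 (+) x (map2 (-) y x) = y"
    "map2 (+) (map2 (-) x z) y = map2 (-) (map2 (+) x y) z"
    "map2 (+) y (map2 (-) x z) = map2 (-) (map2 (+) y x) z"
    "map2 (+) x y = map2 (+) y x"
    "sum_list (map2 (+) x y) = sum_list x + sum_list y"
    "sum_list (map2 (-) x y) = sum_list x - sum_list y"
    by (simp_all add: x y z)
qed

text \<open>The hypotheses are the only properties of structure constants that are used. The
  relation \<open>assoc\<close>, with the simple root \<alpha> as an outer member of the triple,
  reduces a constant to two constants of smaller height and one extraspecial constant.\<close>

lemma signs_determined_coeffs:
  fixes n :: "real ^ 8 \<Rightarrow> real ^ 8 \<Rightarrow> int"
  assumes antisym: "\<And>r s. r \<in> E6 \<Longrightarrow> s \<in> E6 \<Longrightarrow> r + s \<in> E6 \<Longrightarrow> n s r = - n r s"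
    and unit: "\<And>r s. r \<in> E6 \<Longrightarrow> s \<in> E6 \<Longrightarrow> r + s \<in> E6 \<Longrightarrow> n r s * n r s = 1"
    and assoc: "\<And>a b c. a \<in> E6 \<Longrightarrow> b \<in> E6 \<Longrightarrow> c \<in> E6 \<Longrightarrow> a + b \<in> E6 \<Longrightarrow> b + c \<in> E6 \<Longrightarrow> a + b + c \<in> E6 \<Longrightarrow>
        a \<bullet> c = 0 \<Longrightarrow> n a b * n (a + b) c = n b c * n a (b + c)"
    and extra: "\<And>r s. extraspecial r s \<Longrightarrow> n r s = 1"
    and "p \<in> set pos_coeffs" "q \<in> set pos_coeffs" "map2 (+) p q \<in> set pos_coeffs"
  shows "n (root_comb p) (root_comb q) = sgn_coeffs p q"
  using assms(5-7)
proof (induction "nat (sum_list p + sum_list q)" arbitrary: p q rule: less_induct)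
  case less
  note IH = less.hyps
  \<comment> \<open>Stated for any ordered pair of the same total height, so that it applies both to
    \<open>(p, q)\<close> and to \<open>(q, p)\<close>.\<close>
  have main: "n (root_comb p') (root_comb q') = eta_coeffs p' q'"
    if p: "p' \<in> set pos_coeffs" and q: "q' \<in> set pos_coeffs" and r: "map2 (+) p' q' \<in> set pos_coeffs"
      and less: "ord_class.lexordp p' q'" and ht: "sum_list p' + sum_list q' = sum_list p + sum_list q" for p' q'
  proof -
    define r where "r = map2 (+) p' q'"
    define \<alpha> where "\<alpha> = first_simple r"
    have len: "length p' = 6" "length q' = 6" using p q by (simp_all add: length_pos_coeffs)
    have sum: "root_comb r = root_comb p' + root_comb q'" using len by (simp add: r_def root_comb_add)
    have inE: "root_comb p' \<in> E6" "root_comb q' \<in> E6" "root_comb p' + root_comb q' \<in> E6"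
      using p q r by (simp_all flip: sum add: r_def root_comb_pos_in_E6)
    have "cartan_form p' q' = -1"
      using E6_add_imp_inner[OF inE] by (simp add: root_comb_inner)
    \<comment> \<open>The three cases: the pair is extraspecial, or \<alpha> can be subtracted from
      the first member, or from the second.\<close>
    then have chk: "p' = \<alpha> \<and> eta_coeffs p' q' = 1 \<or>
        cartan_form \<alpha> p' = 1 \<and> (let \<delta> = map2 (-) p' \<alpha> in \<delta> \<in> set pos_coeffs \<and>
           sgn_coeffs \<alpha> \<delta> * sgn_coeffs \<delta> q' = eta_coeffs p' q') \<or>
        cartan_form \<alpha> q' = 1 \<and> (let \<delta> = map2 (-) q' \<alpha> in \<delta> \<in> set pos_coeffs \<and>
           sgn_coeffs \<alpha> \<delta> * sgn_coeffs p' \<delta> = eta_coeffs p' q')"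
      using eta_check[rule_format, OF p q] less unfolding Let_def \<alpha>_def r_def by satx
    have ht_pos: "0 < sum_list x" if "x \<in> set pos_coeffs" for x
      using pos_coeffs_check that by blast
    have "r \<notin> set simple_coeffs"
    proof
      assume "r \<in> set simple_coeffs"
      then have "sum_list r = 1" by (auto simp: simple_coeffs_def)
      moreover have "sum_list r = sum_list p' + sum_list q'"
        unfolding r_def using len by (simp add: list6_arith)
      ultimately show False using ht_pos[OF p] ht_pos[OF q] by simp
    qed
    have es: "extraspecial (root_comb \<alpha>) (root_comb (map2 (-) r \<alpha>))"
      unfolding \<alpha>_def using r \<open>r \<notin> _\<close> by (intro extraspecial_first_simple) (simp_all add: r_def)
    have \<alpha>: "\<alpha> \<in> set pos_coeffs" and s: "map2 (-) r \<alpha> \<in> set pos_coeffs"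
      using first_simple_check[rule_format, OF r] \<open>r \<notin> _\<close> simple_coeffs_subset unfolding Let_def \<alpha>_def r_def by blast+
    have len\<alpha>: "length \<alpha> = 6" and lenr: "length r = 6" using \<alpha> len by (simp_all add: length_pos_coeffs r_def)
    have N1: "n (root_comb \<alpha>) (root_comb (map2 (-) r \<alpha>)) = 1" using extra[OF es] .
    have s_eq: "root_comb (map2 (-) r \<alpha>) = root_comb p' + root_comb q' - root_comb \<alpha>"
      using len\<alpha> lenr sum by (simp add: root_comb_diff)
    have \<alpha>E: "root_comb \<alpha> \<in> E6" "root_comb p' + root_comb q' - root_comb \<alpha> \<in> E6"
      using root_comb_pos_in_E6[OF \<alpha>] root_comb_pos_in_E6[OF s] by (simp_all add: s_eq)
    \<comment> \<open>The sum, \<alpha> and their difference all have squared length 2.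
      Consequently, if \<alpha> has inner product 1 with one member of the pair, it is orthogonal to
      the other.\<close>
    have cartan_form\<alpha>: "root_comb \<alpha> \<bullet> (root_comb p' + root_comb q') = 1"
      using E6_inner_self[OF \<alpha>E(1)] E6_inner_self[OF \<alpha>E(2)] E6_inner_self[OF inE(3)]
      by (simp add: inner_diff_left inner_diff_right inner_commute)
    from chk consider "p' = \<alpha>" "eta_coeffs p' q' = 1"
      | (left) "cartan_form \<alpha> p' = 1" "map2 (-) p' \<alpha> \<in> set pos_coeffs"
          "sgn_coeffs \<alpha> (map2 (-) p' \<alpha>) * sgn_coeffs (map2 (-) p' \<alpha>) q' = eta_coeffs p' q'"
      | (right) "cartan_form \<alpha> q' = 1" "map2 (-) q' \<alpha> \<in> set pos_coeffs"
          "sgn_coeffs \<alpha> (map2 (-) q' \<alpha>) * sgn_coeffs p' (map2 (-) q' \<alpha>) = eta_coeffs p' q'"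
      unfolding Let_def by satx
    then show ?thesis
    proof cases
      case 1
      then have "root_comb q' = root_comb (map2 (-) r \<alpha>)" by (simp add: s_eq)
      then show ?thesis using N1 1 by simp
    next
      case left
      define \<delta> where "\<delta> = map2 (-) p' \<alpha>"
      have d: "\<delta> \<in> set pos_coeffs" "root_comb \<delta> = root_comb p' - root_comb \<alpha>"
        using left len len\<alpha> by (simp_all add: \<delta>_def root_comb_diff)
      have h: "sum_list \<delta> = sum_list p' - sum_list \<alpha>" using len len\<alpha> by (simp add: \<delta>_def list6_arith)
      have "map2 (+) \<alpha> \<delta> = p'" "map2 (+) \<delta> q' = map2 (-) r \<alpha>"
        unfolding \<delta>_def r_def using len len\<alpha> by (simp_all add: list6_arith)
      \<comment> \<open>Both pairs have smaller total height: the first sums to \<open>p'\<close>,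
        the second to the original sum minus \<alpha>.\<close>
      then have "n (root_comb \<alpha>) (root_comb \<delta>) = sgn_coeffs \<alpha> \<delta>"
        "n (root_comb \<delta>) (root_comb q') = sgn_coeffs \<delta> q'"
        using ht h ht_pos[OF \<alpha>] ht_pos[OF q] ht_pos[OF p] ht_pos[OF d(1)] d(1) \<alpha> p q s
        by (auto intro!: IH)
      \<comment> \<open>Here \<alpha> is orthogonal to \<open>q'\<close>, and the last factor is the
        extraspecial constant, equal to 1. As the first factor is its own inverse, the wanted
        constant can be solved for.\<close>
      moreover have "n (root_comb \<alpha>) (root_comb \<delta>) * n (root_comb \<alpha> + root_comb \<delta>) (root_comb q') =
         n (root_comb \<delta>) (root_comb q') * n (root_comb \<alpha>) (root_comb \<delta> + root_comb q')"
        using cartan_form\<alpha> left(1) inE \<alpha>E root_comb_pos_in_E6[OF d(1)]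
        by (intro assoc) (simp_all add: d(2) inner_add_right root_comb_inner algebra_simps)
      moreover have "root_comb \<delta> + root_comb q' = root_comb (map2 (-) r \<alpha>)"
        by (simp add: s_eq d(2))
      moreover have "n (root_comb \<alpha>) (root_comb \<delta>) * n (root_comb \<alpha>) (root_comb \<delta>) = 1"
        using inE \<alpha>E root_comb_pos_in_E6[OF d(1)] by (intro unit) (simp_all add: d(2))
      ultimately have "sgn_coeffs \<alpha> \<delta> * n (root_comb p') (root_comb q') = sgn_coeffs \<delta> q'"
         "sgn_coeffs \<alpha> \<delta> * sgn_coeffs \<alpha> \<delta> = 1"
        using N1 by (simp_all add: d(2))
      then have "n (root_comb p') (root_comb q') = sgn_coeffs \<alpha> \<delta> * sgn_coeffs \<delta> q'"
        by (metis mult.assoc mult_1)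
      then show ?thesis using left(3) by (simp add: \<delta>_def)
    next
      case right
      define \<delta> where "\<delta> = map2 (-) q' \<alpha>"
      have d: "\<delta> \<in> set pos_coeffs" "root_comb \<delta> = root_comb q' - root_comb \<alpha>"
        using right len len\<alpha> by (simp_all add: \<delta>_def root_comb_diff)
      have h: "sum_list \<delta> = sum_list q' - sum_list \<alpha>" using len len\<alpha> by (simp add: \<delta>_def list6_arith)
      have "map2 (+) \<alpha> \<delta> = q'" "map2 (+) p' \<delta> = map2 (-) r \<alpha>"
        unfolding \<delta>_def r_def using len len\<alpha> by (simp_all add: list6_arith)
      then have "n (root_comb \<alpha>) (root_comb \<delta>) = sgn_coeffs \<alpha> \<delta>"
        "n (root_comb p') (root_comb \<delta>) = sgn_coeffs p' \<delta>"
        using ht h ht_pos[OF \<alpha>] ht_pos[OF q] ht_pos[OF p] ht_pos[OF d(1)] d(1) \<alpha> p q s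
        by (auto intro!: IH)
      \<comment> \<open>Now \<alpha> stands last in the triple and is orthogonal to
        \<open>p'\<close>. Two constants appear with their arguments reversed, and the two resulting
        signs cancel.\<close>
      moreover have "n (root_comb p') (root_comb \<delta>) * n (root_comb p' + root_comb \<delta>) (root_comb \<alpha>) =
         n (root_comb \<delta>) (root_comb \<alpha>) * n (root_comb p') (root_comb \<delta> + root_comb \<alpha>)"
        using cartan_form\<alpha> right(1) inE \<alpha>E root_comb_pos_in_E6[OF d(1)]
        by (intro assoc) (simp_all add: d(2) inner_add_right root_comb_inner inner_commute algebra_simps)
      moreover have "root_comb p' + root_comb \<delta> = root_comb (map2 (-) r \<alpha>)"
        by (simp add: s_eq d(2))
      moreover have "n (root_comb (map2 (-) r \<alpha>)) (root_comb \<alpha>) = -1"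
        using antisym[of "root_comb \<alpha>" "root_comb (map2 (-) r \<alpha>)"] N1 \<alpha>E inE by (simp add: s_eq)
      moreover have "n (root_comb \<delta>) (root_comb \<alpha>) = - n (root_comb \<alpha>) (root_comb \<delta>)"
        using inE \<alpha>E root_comb_pos_in_E6[OF d(1)] by (intro antisym) (simp_all add: d(2))
      moreover have "n (root_comb \<alpha>) (root_comb \<delta>) * n (root_comb \<alpha>) (root_comb \<delta>) = 1"
        using inE \<alpha>E root_comb_pos_in_E6[OF d(1)] by (intro unit) (simp_all add: d(2))
      ultimately have "sgn_coeffs p' \<delta> = sgn_coeffs \<alpha> \<delta> * n (root_comb p') (root_comb q')"
         "sgn_coeffs \<alpha> \<delta> * sgn_coeffs \<alpha> \<delta> = 1"
        by (simp_all add: d(2))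
      then have "n (root_comb p') (root_comb q') = sgn_coeffs \<alpha> \<delta> * sgn_coeffs p' \<delta>"
        by (metis mult.assoc mult_1)
      then show ?thesis using right(3) by (simp add: \<delta>_def)
    qed
  qed
  have len: "length p = 6" "length q = 6" using less.prems by (simp_all add: length_pos_coeffs)
  have inE: "root_comb p \<in> E6" "root_comb q \<in> E6" "root_comb p + root_comb q \<in> E6"
    using less.prems len by (simp_all flip: root_comb_add add: root_comb_pos_in_E6)
  show ?case
  proof (cases "ord_class.lexordp p q")
    case True
    then show ?thesis using main less.prems by (simp add: sgn_coeffs_def)
  next
    case False
    \<comment> \<open>Equality would make the inner product 2 instead of -1.\<close>
    have "p \<noteq> q" using E6_add_imp_inner[OF inE] E6_inner_self[OF inE(1)] by auto
    with False have "ord_class.lexordp q p" using lexordp_linear by blast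
    then have "n (root_comb q) (root_comb p) = eta_coeffs q p"
      using main[of q p] less.prems len list6_arith(4)[of p q p] by (simp add: add.commute)
    then show ?thesis using False antisym[OF inE] by (simp add: sgn_coeffs_def)
  qed
qed

lemma signs_determined:
  fixes n :: "real ^ 8 \<Rightarrow> real ^ 8 \<Rightarrow> int"
  assumes "\<And>r s. r \<in> E6 \<Longrightarrow> s \<in> E6 \<Longrightarrow> r + s \<in> E6 \<Longrightarrow> n s r = - n r s"
    and "\<And>r s. r \<in> E6 \<Longrightarrow> s \<in> E6 \<Longrightarrow> r + s \<in> E6 \<Longrightarrow> n r s * n r s = 1"
    and "\<And>a b c. a \<in> E6 \<Longrightarrow> b \<in> E6 \<Longrightarrow> c \<in> E6 \<Longrightarrow> a + b \<in> E6 \<Longrightarrow> b + c \<in> E6 \<Longrightarrow> a + b + c \<in> E6 \<Longrightarrow>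
        a \<bullet> c = 0 \<Longrightarrow> n a b * n (a + b) c = n b c * n a (b + c)"
    and "\<And>r s. extraspecial r s \<Longrightarrow> n r s = 1"
    and pq: "p \<in> positive_roots" "q \<in> positive_roots" "prec p q" "p + q \<in> E6"
  shows "of_int (n p q) = (eta p q :: 'k::field)"
proof -
  from pq obtain x y where xy: "x \<in> set pos_coeffs" "y \<in> set pos_coeffs" "p = root_comb x" "q = root_comb y"
    by (auto simp: positive_roots_eq)
  have len: "length x = 6" "length y = 6" using xy by (simp_all add: length_pos_coeffs)
  have "0 < sum_list (map2 (+) x y)"
    using pos_coeffs_check[rule_format, OF xy(1)] pos_coeffs_check[rule_format, OF xy(2)] len
    by (simp add: list6_arith)
  then have "map2 (+) x y \<in> set pos_coeffs"
    using mem_pos_coeffs_iff[of "map2 (+) x y"] pq(4) len by (simp add: xy root_comb_add)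
  then have "n p q = sgn_coeffs x y"
    unfolding xy using assms xy by (intro signs_determined_coeffs) blast+
  moreover have "ord_class.lexordp x y" using pq(3) len by (simp add: xy prec_iff_lexordp)
  ultimately show ?thesis using len by (simp add: xy eta_root_comb sgn_coeffs_def)
qed

section \<open>Chevalley bases\<close>

context complex_lie_algebra
begin

section \<open>Elementary identities in a Lie algebra\<close>

lemma bracket_zero_left [simp]: "bracket 0 x = 0"
  using bracket_add_left[of 0 0 x] by simp

lemma bracket_zero_right [simp]: "bracket x 0 = 0"
  using bracket_add_right[of x 0 0] by simp

lemma bracket_minus_left [simp]: "bracket (- x) y = - bracket x y"
  using minus_unique[of "bracket x y" "bracket (- x) y"] by (simp flip: bracket_add_left)

lemma bracket_minus_right [simp]: "bracket x (- y) = - bracket x y"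
  using minus_unique[of "bracket x y" "bracket x (- y)"] by (simp flip: bracket_add_right)

lemma bracket_diff_left: "bracket (x - y) z = bracket x z - bracket y z"
  using bracket_add_left[of x "- y" z] by simp

lemma bracket_swap: "bracket x y = - bracket y x"
proof -
  have "bracket x y + bracket y x = 0"
    using bracket_self[of "x + y"] bracket_self[of x] bracket_self[of y]
    by (simp add: bracket_add_left bracket_add_right add.commute)
  then show ?thesis by (rule eq_neg_iff_add_eq_0[THEN iffD2])
qed

lemma bracket_derivation: "bracket x (bracket y z) = bracket (bracket x y) z + bracket y (bracket x z)"
proof -
  have "bracket z (bracket x y) = - bracket (bracket x y) z" "bracket y (bracket z x) = - bracket y (bracket x z)"
    by (simp_all add: bracket_swap[of z])
  with jacobi[of x y z] show ?thesis by (simp add: algebra_simps)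
qed

lemma linear_bracket: "Vector_Spaces.linear scale scale (bracket x)"
  by unfold_locales (simp_all add: bracket_add_right bracket_scale_right)

text \<open>The centre is an ideal, and it is proper because a simple algebra has a non-zero
  bracket. By linearity centrality can be tested on a spanning set.\<close>

lemma center_trivial:
  assumes simple "span B = UNIV" "\<And>b. b \<in> B \<Longrightarrow> bracket x b = 0"
  shows "x = 0"
proof -
  let ?Z = "{x. \<forall>y. bracket x y = 0}"
  have "lie_ideal ?Z"
    unfolding lie_ideal_def
  proof (intro conjI subspaceI allI ballI)
    fix x y assume "y \<in> ?Z"
    then have "bracket x y = 0" by (subst bracket_swap) simp
    then show "bracket x y \<in> ?Z" by simp
  qed (simp_all add: bracket_add_left bracket_scale_left)
  moreover have "?Z \<noteq> UNIV" using \<open>simple\<close> unfolding simple_def by blast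
  ultimately have "?Z = {0}" using \<open>simple\<close> unfolding simple_def by blast
  moreover have "bracket x y = 0" for y
  proof -
    have "y \<in> span B" using assms by simp
    then show ?thesis
      by (induction rule: span_induct)
        (auto intro!: subspaceI simp: assms(3) bracket_add_right bracket_scale_right)
  qed
  ultimately show ?thesis by blast
qed

end

text \<open>Reduces a commutator formula to an equation between products, so that inverses of root
  elements do not enter its verification.\<close>

lemma (in group) group_commutator_eqI:
  assumes "x \<in> carrier G" "y \<in> carrier G" "z \<in> carrier G" "x \<otimes> y = y \<otimes> (x \<otimes> z)"
  shows "group_commutator G x y = z"
proof -
  have "inv x \<otimes> inv y \<otimes> x \<otimes> y = inv x \<otimes> (inv y \<otimes> (x \<otimes> y))"
    using assms(1-3) by (simp add: m_assoc)
  also have "\<dots> = inv x \<otimes> (inv y \<otimes> (y \<otimes> (x \<otimes> z)))"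
    by (simp only: assms(4))
  also have "\<dots> = z" using assms(1-3) by (simp add: m_assoc[symmetric])
  finally show ?thesis by (simp add: group_commutator_def)
qed

section \<open>Root vectors and coroots of a Chevalley basis\<close>

locale E6_chevalley = complex_lie_algebra scale bracket
  for scale :: "complex \<Rightarrow> 'l::ab_group_add \<Rightarrow> 'l" and bracket :: "'l \<Rightarrow> 'l \<Rightarrow> 'l" +
  fixes H :: "'l set" and \<phi> :: "real ^ 8 \<Rightarrow> 'l \<Rightarrow> complex" and e :: "real ^ 8 \<Rightarrow> 'l"
  assumes simple_E6: "simple_of_type_E6 H \<phi>"
    and chevalley: "chevalley_basis H \<phi> e"
begin

abbreviation B where "B \<equiv> basis_set e"

definition h :: "real ^ 8 \<Rightarrow> 'l" where "h r = bracket (e r) (e (- r))"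

lemma independent_B: "independent B" and span_B: "span B = UNIV"
  using chevalley by (simp_all add: chevalley_basis_def)

lemma simple_roots_subset: "simple_roots \<subseteq> E6"
proof -
  have "simple_roots \<subseteq> root_comb ` set simple_coeffs"
    by (simp add: simple_roots_def simple_coeffs_def root_comb_def)
  then show ?thesis using simple_coeffs_subset root_comb_pos_in_E6 by blast
qed

lemma B_cases:
  assumes "b \<in> B"
  obtains r where "r \<in> E6" "b = e r" | r where "r \<in> simple_roots" "r \<in> E6" "b = h r"
  using assms simple_roots_subset by (auto simp: basis_set_def h_def)

lemma e_in_B: "r \<in> E6 \<Longrightarrow> e r \<in> B" and h_in_B: "r \<in> simple_roots \<Longrightarrow> h r \<in> B"
  by (auto simp: basis_set_def h_def)

lemma e_nonzero: "r \<in> E6 \<Longrightarrow> e r \<noteq> 0"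
  using e_in_B independent_B dependent_zero by metis

lemma e_scale_cancel: "r \<in> E6 \<Longrightarrow> scale c (e r) = scale d (e r) \<longleftrightarrow> c = d"
  using e_nonzero by (simp add: scale_cancel_right)

lemma subspace_H: "subspace H"
  using simple_E6 by (simp add: simple_of_type_E6_def cartan_subalgebra_def)

lemma \<phi>_linear: "x \<in> H \<Longrightarrow> linear (\<lambda>v. \<phi> v x)"
  using simple_E6 by (simp add: simple_of_type_E6_def)

lemma coroot: "r \<in> E6 \<Longrightarrow> is_coroot H (\<phi> r) (h r)"
  using chevalley by (simp add: chevalley_basis_def h_def)

lemma h_in_H: "r \<in> E6 \<Longrightarrow> h r \<in> H"
  using coroot by (simp add: is_coroot_def)

lemma \<phi>_h: "r \<in> E6 \<Longrightarrow> s \<in> E6 \<Longrightarrow> \<phi> s (h r) = of_real (s \<bullet> r)"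
  using simple_E6 coroot[of r] E6_inner_self[of r] unfolding simple_of_type_E6_def by fastforce

lemma bracket_H_e: "x \<in> H \<Longrightarrow> r \<in> E6 \<Longrightarrow> bracket x (e r) = scale (\<phi> r x) (e r)"
  using chevalley unfolding chevalley_basis_def root_space_def by blast

lemma bracket_h_e: "r \<in> E6 \<Longrightarrow> s \<in> E6 \<Longrightarrow> bracket (h r) (e s) = scale (of_real (s \<bullet> r)) (e s)"
  by (simp add: bracket_H_e h_in_H \<phi>_h)

lemma bracket_e_h: "r \<in> E6 \<Longrightarrow> s \<in> E6 \<Longrightarrow> bracket (e r) (h s) = scale (- of_real (r \<bullet> s)) (e r)"
  by (subst bracket_swap) (simp add: bracket_h_e)

lemma \<phi>_uminus: "x \<in> H \<Longrightarrow> \<phi> (- r) x = - \<phi> r x"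
  using linear_neg[OF \<phi>_linear] by simp

text \<open>The derivation rule gives two terms with the opposite weights \<open>\<phi> r x\<close>
  and \<open>\<phi> (- r) x\<close>, which cancel.\<close>

lemma bracket_H_h: "x \<in> H \<Longrightarrow> r \<in> E6 \<Longrightarrow> bracket x (h r) = 0"
  unfolding h_def
  by (subst bracket_derivation)
    (simp add: bracket_H_e E6_uminus \<phi>_uminus bracket_scale_left bracket_scale_right)

text \<open>Linearity of the roots on \<open>H\<close> is not available as a hypothesis, so relations between coroots are
  proved by showing that a difference is central.\<close>

lemma H_eq_0I:
  assumes "x \<in> H" "\<And>r. r \<in> E6 \<Longrightarrow> bracket x (e r) = 0"
  shows "x = 0"
proof (rule center_trivial[OF _ span_B])
  show "simple" using simple_E6 by (simp add: simple_of_type_E6_def)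
  show "bracket x b = 0" if "b \<in> B" for b
    using that by (cases rule: B_cases) (simp_all add: assms bracket_H_h)
qed

lemma h_uminus: "h (- r) = - h r"
  unfolding h_def by (subst bracket_swap) simp

text \<open>Since all roots have the same length, the eigenvalue of \<open>h r\<close> on
  \<open>e t\<close> is the inner product of \<open>t\<close> and \<open>r\<close>, which is
  additive in \<open>r\<close>.\<close>

lemma h_add:
  assumes "r \<in> E6" "s \<in> E6" "r + s \<in> E6"
  shows "h (r + s) = h r + h s"
proof -
  have "h (r + s) - (h r + h s) = 0"
  proof (rule H_eq_0I)
    show "h (r + s) - (h r + h s) \<in> H"
      using assms by (intro subspace_diff subspace_add subspace_H h_in_H)
    fix t assume "t \<in> E6"
    then show "bracket (h (r + s) - (h r + h s)) (e t) = 0"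
      using assms
      by (simp add: bracket_diff_left bracket_add_left bracket_h_e inner_add_right scale_left_distrib)
  qed
  then show ?thesis by simp
qed

text \<open>Every coroot is an integral combination of the simple coroots. This is what later places
  \<open>h r\<close> in the lattice.\<close>

lemma h_root_comb:
  assumes "root_comb [f', e', b', d', c', a'] \<in> E6"
  shows "h (root_comb [f', e', b', d', c', a']) =
     scale (of_int f') (h rf) + scale (of_int e') (h re) + scale (of_int b') (h rb) +
     scale (of_int d') (h rd) + scale (of_int c') (h rc) + scale (of_int a') (h ra)" (is "h ?r = ?s")
proof -
  have mem: "rf \<in> E6" "re \<in> E6" "rb \<in> E6" "rd \<in> E6" "rc \<in> E6" "ra \<in> E6"
    using simple_roots_subset by (auto simp: simple_roots_def)
  have "h ?r - ?s = 0"
  proof (rule H_eq_0I)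
    show "h ?r - ?s \<in> H"
      using assms mem by (intro subspace_diff subspace_add subspace_scale subspace_H h_in_H)
    fix t assume "t \<in> E6"
    then show "bracket (h ?r - ?s) (e t) = 0"
      using assms mem
      by (simp add: bracket_diff_left bracket_add_left bracket_scale_left bracket_h_e root_comb_Cons inner_add_right
        flip: scale_left_distrib)
  qed
  then show ?thesis by simp
qed

section \<open>Brackets of root vectors and relations between structure constants\<close>

lemma bracket_e_e_eq_0:
  assumes r: "r \<in> E6" and s: "s \<in> E6" and "r + s \<notin> E6" "r + s \<noteq> 0"
  shows "bracket (e r) (e s) = 0"
proof (rule ccontr)
  define y where "y = bracket (e r) (e s)"
  assume nonzero: "bracket (e r) (e s) \<noteq> 0"
  \<comment> \<open>A non-zero bracket would be a vector of this weight. The restriction makes the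
    weight extensional, as membership in \<open>lie_roots\<close> demands.\<close>
  define \<alpha> where "\<alpha> = restrict (\<phi> (r + s)) H"
  have \<alpha>: "\<alpha> x = \<phi> r x + \<phi> s x" if "x \<in> H" for x
    using that linear_add[OF \<phi>_linear] by (simp add: \<alpha>_def)
  have "y \<in> root_space H \<alpha>"
    unfolding root_space_def y_def
    by (auto simp: bracket_derivation[of _ "e r"] bracket_H_e r s bracket_scale_left bracket_scale_right \<alpha>
        scale_left_distrib)
  \<comment> \<open>If the weight vanished on both coroots, \<open>r + s\<close> would be orthogonal
    to itself.\<close>
  moreover have "\<exists>x\<in>H. \<alpha> x \<noteq> 0"
  proof (rule ccontr)
    assume "\<not> ?thesis"
    then have "\<alpha> (h r) = 0" "\<alpha> (h s) = 0" using h_in_H r s by auto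
    then have "(r + s) \<bullet> r = 0" "(r + s) \<bullet> s = 0"
      using r s by (simp_all add: \<alpha> h_in_H \<phi>_h inner_add_left flip: of_real_add)
    then have "(r + s) \<bullet> (r + s) = 0" by (simp only: inner_add_right)
    then show False using assms by simp
  qed
  moreover have "\<alpha> \<in> extensional H" by (simp add: \<alpha>_def)
  ultimately have "\<alpha> \<in> lie_roots H"
    using nonzero unfolding lie_roots_def y_def by blast
  moreover have "\<phi> ` E6 = lie_roots H"
    using simple_E6 by (simp add: simple_of_type_E6_def bij_betw_def)
  ultimately obtain t where t: "t \<in> E6" "\<phi> t = \<alpha>"
    by (metis imageE)
  \<comment> \<open>Evaluating the weight on all coroots shows that the difference of
    \<open>t\<close> and \<open>r + s\<close> is orthogonal to every root, hence to itself.\<close>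
  have "(t - (r + s)) \<bullet> u = 0" if "u \<in> E6" for u
  proof -
    have "\<phi> t (h u) = \<phi> r (h u) + \<phi> s (h u)" using t(2) \<alpha>[OF h_in_H[OF that]] by simp
    then show ?thesis
      using that t(1) r s by (simp add: \<phi>_h inner_diff_left inner_add_left flip: of_real_add)
  qed
  from this[OF t(1)] this[OF r] this[OF s]
  have "(t - (r + s)) \<bullet> (t - (r + s)) = 0" by (simp only: inner_diff_right inner_add_right)
  then have "t = r + s" by simp
  then show False using t assms by simp
qed

text \<open>Integer values can be read in any field. The value 0 when \<open>r + s\<close> is no
  root lets \<open>bracket_e_e\<close> cover all cases with \<open>r + s\<close> non-zero.\<close>

definition N :: "real ^ 8 \<Rightarrow> real ^ 8 \<Rightarrow> int" where
  "N r s = (if r + s \<in> E6 then if structure_const e r s = 1 then 1 else -1 else 0)"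

lemma structure_const_cases:
  assumes "r \<in> E6" "s \<in> E6" "r + s \<in> E6"
  shows "structure_const e r s = of_int (N r s)" "N r s = 1 \<or> N r s = -1"
proof -
  have "structure_const e r s \<in> {1, -1}"
    using assms chevalley unfolding chevalley_basis_def by blast
  then show "structure_const e r s = of_int (N r s)" "N r s = 1 \<or> N r s = -1"
    using assms by (auto simp: N_def)
qed

lemma bracket_e_e:
  assumes "r \<in> E6" "s \<in> E6" "r + s \<noteq> 0"
  shows "bracket (e r) (e s) = scale (of_int (N r s)) (e (r + s))"
proof (cases "r + s \<in> E6")
  case True
  then have "bracket (e r) (e s) = scale (structure_const e r s) (e (r + s))"
    using assms chevalley unfolding chevalley_basis_def by blast
  then show ?thesis using structure_const_cases[OF assms(1,2) True] by simp
next
  case False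
  then show ?thesis using bracket_e_e_eq_0[OF assms(1,2) False assms(3)] by (simp add: N_def)
qed

lemma N_square: "r \<in> E6 \<Longrightarrow> s \<in> E6 \<Longrightarrow> r + s \<in> E6 \<Longrightarrow> N r s * N r s = 1"
  using structure_const_cases(2)[of r s] by auto

lemma N_swap:
  assumes "r \<in> E6" "s \<in> E6" "r + s \<in> E6"
  shows "N s r = - N r s"
proof -
  have "r + s \<noteq> 0" using assms E6_nonzero by blast
  then have "scale (of_int (N s r)) (e (r + s)) = scale (of_int (- N r s)) (e (r + s))"
    using bracket_swap[of "e r" "e s"] assms by (simp add: bracket_e_e add.commute)
  then show ?thesis using e_scale_cancel[OF assms(3)] by (simp only: of_int_eq_iff)
qed

text \<open>Orthogonality makes \<open>a + c\<close> neither a root nor zero, so one of the three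
  terms of the Jacobi identity vanishes and the other two are multiples of the same root
  vector.\<close>

lemma N_assoc:
  assumes "a \<in> E6" "b \<in> E6" "c \<in> E6" "a + b \<in> E6" "b + c \<in> E6" "a + b + c \<in> E6" "a \<bullet> c = 0"
  shows "N a b * N (a + b) c = N b c * N a (b + c)"
proof -
  have "a + c \<notin> E6" using E6_add_imp_inner[of a c] assms by auto
  moreover have "a + c \<noteq> 0"
    using assms E6_inner_self[of a] by (metis add_eq_0_iff inner_minus_right neg_equal_0_iff_equal zero_neq_numeral)
  ultimately have ac: "bracket (e a) (e c) = 0" using assms by (intro bracket_e_e_eq_0)
  have "a + b \<noteq> 0" "b + c \<noteq> 0" "a + b + c \<noteq> 0" using assms E6_nonzero by blast+
  then have "scale (of_int (N b c * N a (b + c))) (e (a + b + c)) = scale (of_int (N a b * N (a + b) c)) (e (a + b + c))"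
    using bracket_derivation[of "e a" "e b" "e c"] assms
    by (simp add: ac bracket_e_e bracket_scale_left bracket_scale_right add.assoc)
  then show ?thesis using e_scale_cancel[OF assms(6)] by (simp only: of_int_eq_iff)
qed

text \<open>For three roots with sum zero the Jacobi identity is a linear relation between coroots.
  As \<open>h t = - (h r + h s)\<close>, it compares the three constants.\<close>

lemma N_cyclic:
  assumes "r \<in> E6" "s \<in> E6" "r + s \<in> E6"
  shows "N s (- (r + s)) = N r s" "N (- (r + s)) r = N r s"
proof -
  define t where "t = - (r + s)"
  have t: "t \<in> E6" "s + t = - r" "t + r = - s" "r + s = - t" using assms E6_uminus[of "r + s"] by (simp_all add: t_def)
  have nz: "- r \<noteq> 0" "- s \<noteq> 0" "- t \<noteq> 0" using assms(1,2) t(1) by (simp_all add: E6_nonzero)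
  have "bracket (e r) (bracket (e s) (e t)) = scale (of_int (N s t)) (h r)"
    "bracket (e s) (bracket (e t) (e r)) = scale (of_int (N t r)) (h s)"
    "bracket (e t) (bracket (e r) (e s)) = scale (of_int (N r s)) (h t)"
    using assms t nz by (simp_all add: bracket_e_e bracket_scale_right h_def)
  moreover have "h t = - (h r + h s)"
    unfolding t_def h_uminus h_add[OF assms] ..
  ultimately have "scale (of_int (N s t)) (h r) + scale (of_int (N t r)) (h s) + scale (of_int (N r s)) (- (h r + h s)) = 0"
    using jacobi[of "e r" "e s" "e t"] by simp
  then have *: "scale (of_int (N s t - N r s)) (h r) + scale (of_int (N t r - N r s)) (h s) = 0"
    by (simp add: scale_left_diff_distrib scale_right_distrib algebra_simps)
  have "scale (of_int (N s t - N r s) * of_real (u \<bullet> r) + of_int (N t r - N r s) * of_real (u \<bullet> s)) (e u) = 0"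
    if "u \<in> E6" for u
    using arg_cong[OF *, of "\<lambda>x. bracket x (e u)"] that assms
    by (simp add: bracket_add_left bracket_scale_left bracket_h_e scale_left_distrib)
  then have "of_int (N s t - N r s) * complex_of_real (u \<bullet> r) + of_int (N t r - N r s) * of_real (u \<bullet> s) = 0"
    if "u \<in> E6" for u
    using that e_nonzero[of u] unfolding scale_eq_0_iff by blast
  \<comment> \<open>With \<open>u = r\<close> and \<open>u = s\<close> the two differences
    \<open>x\<close> and \<open>y\<close> of constants satisfy \<open>2 * x - y = 0\<close> and
    \<open>2 * y - x = 0\<close>, so both are zero.\<close>
  from this[of r] this[of s] have eqs: "of_int (2 * (N s t - N r s) - (N t r - N r s)) = (0::complex)"
    "of_int (2 * (N t r - N r s) - (N s t - N r s)) = (0::complex)"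
    using assms E6_add_imp_inner[OF assms] by (simp_all add: E6_inner_self inner_commute[of s r] mult.commute[of _ 2])
  then have "N s t = N r s" "N t r = N r s"
    unfolding of_int_eq_0_iff by presburger+
  then show "N s (- (r + s)) = N r s" "N (- (r + s)) r = N r s"
    by (simp_all only: t_def)
qed

text \<open>In the Jacobi identity for \<open>- r\<close>, \<open>r\<close>, \<open>s\<close> one
  term vanishes because \<open>s - r\<close> is neither a root nor zero. The eigenvalue -1 of
  \<open>h r\<close> on \<open>e s\<close> then yields \<open>N r s * N (- r) (r + s) = 1\<close>,
  and cyclic invariance rewrites the second factor.\<close>

lemma N_uminus:
  assumes "r \<in> E6" "s \<in> E6" "r + s \<in> E6"
  shows "N (- r) (- s) = - N r s"
proof -
  have rs: "r \<bullet> s = -1" using E6_add_imp_inner[OF assms] .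
  have "s + - r \<notin> E6" using E6_add_imp_inner[of s "- r"] assms rs E6_uminus by (auto simp: inner_commute)
  moreover have "s + - r \<noteq> 0" using rs E6_inner_self[OF assms(1)] by auto
  ultimately have sr: "bracket (e s) (e (- r)) = 0"
    using assms E6_uminus by (intro bracket_e_e_eq_0)
  have nz: "r + s \<noteq> 0" "s \<noteq> 0" using assms E6_nonzero by blast+
  have "bracket (e (- r)) (bracket (e r) (e s)) = scale (of_int (N r s * N (- r) (r + s))) (e s)"
    using assms nz E6_uminus by (simp add: bracket_e_e bracket_scale_right)
  moreover have "bracket (e s) (bracket (e (- r)) (e r)) = - e s"
    using h_uminus[of r] assms rs by (simp add: h_def[of "- r"] bracket_e_h inner_commute)
  ultimately have "scale (of_int (N r s * N (- r) (r + s))) (e s) = scale (of_int 1) (e s)"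
    using jacobi[of "e (- r)" "e r" "e s"] by (simp add: sr)
  then have "N r s * N (- r) (r + s) = 1" using e_scale_cancel[OF assms(2)] by (simp only: of_int_eq_iff)
  moreover have "N (- s) (- r) = N (- r) (r + s)"
    using N_cyclic(2)[of "- r" "r + s"] assms E6_uminus by simp
  moreover have "- r + - s \<in> E6" using E6_uminus[OF assms(3)] by simp
  then have "N (- s) (- r) = - N (- r) (- s)"
    using N_swap[of "- r" "- s"] assms E6_uminus by simp
  ultimately show ?thesis using structure_const_cases(2)[OF assms] by auto
qed

section \<open>Extension of scalars\<close>

lemma finite_E6: "finite E6"
  unfolding E6_eq by simp

lemma finite_B: "finite B"
  by (simp add: basis_set_def simple_roots_def finite_E6)

text \<open>The Chevalley \<int>-form of the Lie algebra.\<close>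

definition lattice :: "'l set" where
  "lattice = {x. \<forall>b. representation B x b \<in> \<int>}"

text \<open>Names the matrix entry inside \<open>base_change\<close>. Its value is meaningful when
  the coordinate is an integer, in particular for \<open>x\<close> in
  \<open>lattice\<close>.\<close>

definition coeff :: "'l \<Rightarrow> 'l \<Rightarrow> int" where
  "coeff x b = (THE m. complex_of_int m = representation B x b)"

definition integral :: "('l \<Rightarrow> 'l) \<Rightarrow> bool" where
  "integral f \<longleftrightarrow> Vector_Spaces.linear scale scale f \<and> (\<forall>b\<in>B. f b \<in> lattice)"

lemma coeff_unique: "representation B x b = of_int m \<Longrightarrow> coeff x b = m"
  by (simp add: coeff_def)

lemma of_int_coeff: "x \<in> lattice \<Longrightarrow> complex_of_int (coeff x b) = representation B x b"
  unfolding lattice_def using coeff_unique by (metis Ints_cases mem_Collect_eq)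

lemma lattice_add: "x \<in> lattice \<Longrightarrow> y \<in> lattice \<Longrightarrow> x + y \<in> lattice"
  by (simp add: lattice_def representation_add independent_B span_B)

lemma lattice_scale: "x \<in> lattice \<Longrightarrow> scale (of_int k) x \<in> lattice"
  by (simp add: lattice_def representation_scale independent_B span_B)

lemma lattice_uminus: "x \<in> lattice \<Longrightarrow> - x \<in> lattice"
  by (simp add: lattice_def representation_neg independent_B span_B)

lemma lattice_zero: "0 \<in> lattice"
  by (simp add: lattice_def representation_zero)

lemma B_subset_lattice: "b \<in> B \<Longrightarrow> b \<in> lattice"
  by (simp add: lattice_def representation_basis independent_B)

lemma lattice_sum: "(\<And>i. i \<in> I \<Longrightarrow> x i \<in> lattice) \<Longrightarrow> (\<Sum>i\<in>I. x i) \<in> lattice"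
  by (induction I rule: infinite_finite_induct) (simp_all add: lattice_zero lattice_add)

lemma e_in_lattice: "r \<in> E6 \<Longrightarrow> e r \<in> lattice"
  by (simp add: B_subset_lattice e_in_B)

lemma h_in_lattice:
  assumes "r \<in> E6"
  shows "h r \<in> lattice"
proof -
  from assms obtain x where "length x = 6" "r = root_comb x" by (rule E6_cases)
  then obtain f' e' b' d' c' a' where r: "r = root_comb [f', e', b', d', c', a']"
    using length_6D by blast
  have "h s \<in> lattice" if "s \<in> simple_roots" for s
    using that by (simp add: B_subset_lattice h_in_B)
  then show ?thesis
    using assms unfolding r
    by (simp add: h_root_comb simple_roots_def lattice_add lattice_scale)
qed

lemma coeff_add: "x \<in> lattice \<Longrightarrow> y \<in> lattice \<Longrightarrow> coeff (x + y) b = coeff x b + coeff y b"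
  by (intro coeff_unique) (simp add: of_int_coeff representation_add independent_B span_B)

lemma coeff_scale: "x \<in> lattice \<Longrightarrow> coeff (scale (of_int k) x) b = k * coeff x b"
  by (intro coeff_unique) (simp add: of_int_coeff representation_scale independent_B span_B)

lemma coeff_zero: "coeff 0 b = 0"
  by (intro coeff_unique) (simp add: representation_zero)

lemma coeff_basis: "b \<in> B \<Longrightarrow> coeff b c = (if c = b then 1 else 0)"
  by (intro coeff_unique) (simp add: representation_basis independent_B)

lemma integral_linear: "integral f \<Longrightarrow> Vector_Spaces.linear scale scale f"
  by (simp add: integral_def)

lemma
  assumes f: "integral f" and x: "x \<in> lattice"
  shows integral_in_lattice: "f x \<in> lattice"
    and coeff_integral: "coeff (f x) b = (\<Sum>c\<in>B. coeff x c * coeff (f c) b)"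
proof -
  interpret f: Vector_Spaces.linear scale scale f using f by (rule integral_linear)
  have fc: "f c \<in> lattice" if "c \<in> B" for c using f that by (simp add: integral_def)
  have "x = (\<Sum>c\<in>B. scale (of_int (coeff x c)) c)"
    using sum_representation_eq[OF independent_B _ finite_B] x by (simp add: of_int_coeff span_B)
  then have "f x = f (\<Sum>c\<in>B. scale (of_int (coeff x c)) c)" by simp
  then have fx: "f x = (\<Sum>c\<in>B. scale (of_int (coeff x c)) (f c))"
    by (simp add: f.sum f.scale)
  show "f x \<in> lattice" unfolding fx by (intro lattice_sum lattice_scale fc)
  have "representation B (f x) b = (\<Sum>c\<in>B. of_int (coeff x c) * representation B (f c) b)"
    unfolding fx by (simp add: representation_sum representation_scale independent_B span_B)
  also have "\<dots> = of_int (\<Sum>c\<in>B. coeff x c * coeff (f c) b)"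
    by (simp add: of_int_coeff fc)
  finally show "coeff (f x) b = (\<Sum>c\<in>B. coeff x c * coeff (f c) b)" by (rule coeff_unique)
qed

lemma integral_comp: "integral f \<Longrightarrow> integral g \<Longrightarrow> integral (f \<circ> g)"
  using integral_in_lattice by (auto simp: integral_def intro: Vector_Spaces.linear_compose)

section \<open>Base change of integral operators\<close>

lemma base_change_eq: "base_change e f v = (\<lambda>b\<in>B. \<Sum>b'\<in>B. of_int (coeff (f b') b) * v b')"
  by (simp add: base_change_def coeff_def)

text \<open>The matrix of a composite is the product of the integer matrices, and reading integers
  in \<open>'k\<close> respects sums and products.\<close>

lemma base_change_comp:
  fixes v :: "'l \<Rightarrow> 'k::field"
  assumes "integral f" "integral g"
  shows "base_change e f (base_change e g v) = base_change e (f \<circ> g) v"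
proof
  fix b
  have "(\<Sum>c\<in>B. of_int (coeff (f c) b) * (\<Sum>b'\<in>B. of_int (coeff (g b') c) * v b')) =
      (\<Sum>b'\<in>B. of_int (coeff (f (g b')) b) * v b')" if "b \<in> B"
  proof -
    have "(\<Sum>c\<in>B. of_int (coeff (f c) b) * (\<Sum>b'\<in>B. of_int (coeff (g b') c) * v b')) =
        (\<Sum>b'\<in>B. \<Sum>c\<in>B. of_int (coeff (g b') c * coeff (f c) b) * v b')"
      by (subst sum.swap) (simp add: sum_distrib_left mult_ac)
    also have "\<dots> = (\<Sum>b'\<in>B. of_int (coeff (f (g b')) b) * v b')"
      using assms by (intro sum.cong) (simp_all add: coeff_integral integral_def sum_distrib_right)
    finally show ?thesis .
  qed
  then show "base_change e f (base_change e g v) b = base_change e (f \<circ> g) v b"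
    by (simp add: base_change_eq)
qed

lemma base_change_restrict: "base_change e f (restrict v B) = base_change e f v"
  unfolding base_change_eq by (intro restrict_ext sum.cong) simp_all

lemma base_change_vector_add:
  "b \<in> B \<Longrightarrow> base_change e f (\<lambda>b. v b + w b) b = base_change e f v b + base_change e f w b"
  by (simp add: base_change_eq distrib_left sum.distrib)

lemma base_change_vector_scale:
  "b \<in> B \<Longrightarrow> base_change e f (\<lambda>b. k * v b) b = k * base_change e f v b"
  by (simp add: base_change_eq sum_distrib_left mult_ac)

lemma base_change_add:
  "integral f \<Longrightarrow> integral g \<Longrightarrow> b \<in> B \<Longrightarrow>
    base_change e (\<lambda>x. f x + g x) v b = base_change e f v b + base_change e g v b"
  by (simp add: base_change_eq integral_def coeff_add distrib_right sum.distrib)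

lemma base_change_scale:
  "integral f \<Longrightarrow> b \<in> B \<Longrightarrow>
    base_change e (\<lambda>x. scale (of_int k) (f x)) v b = of_int k * base_change e f v b"
  by (simp add: base_change_eq integral_def coeff_scale sum_distrib_left mult_ac)

lemma base_change_zero: "b \<in> B \<Longrightarrow> base_change e (\<lambda>x. 0) v b = 0"
  by (simp add: base_change_eq coeff_zero)

lemma base_change_id: "b \<in> B \<Longrightarrow> base_change e (\<lambda>x. x) v b = v b"
proof -
  have "of_int (coeff b' b) * v b' = (if b = b' then v b' else 0)" if "b' \<in> B" for b'
    using that by (simp add: coeff_basis)
  then show "b \<in> B \<Longrightarrow> base_change e (\<lambda>x. x) v b = v b"
    by (simp add: base_change_eq finite_B)
qed

section \<open>The operators \<open>ad r\<close> and their divided squares\<close>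

definition ad :: "real ^ 8 \<Rightarrow> 'l \<Rightarrow> 'l" where "ad r = bracket (e r)"
definition ad2 :: "real ^ 8 \<Rightarrow> 'l \<Rightarrow> 'l" where "ad2 r = divided_power (e r) 2"

lemma ad2_eq: "ad2 r x = scale (1 / 2) (ad r (ad r x))"
  by (simp add: ad2_def ad_def divided_power_def numeral_2_eq_2)

lemma linear_ad: "Vector_Spaces.linear scale scale (ad r)"
  unfolding ad_def by (rule linear_bracket)

lemma ad_add: "ad r (x + y) = ad r x + ad r y"
  and ad_scale: "ad r (scale k x) = scale k (ad r x)"
  and ad_zero: "ad r 0 = 0"
  and ad_uminus: "ad r (- x) = - ad r x"
  by (simp_all add: ad_def bracket_add_right bracket_scale_right)

lemma linear_ad2: "Vector_Spaces.linear scale scale (ad2 r)"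
  by unfold_locales (simp_all add: ad2_eq ad_add ad_scale scale_right_distrib mult.commute)

lemma ad_e: "r \<in> E6 \<Longrightarrow> s \<in> E6 \<Longrightarrow> s \<noteq> - r \<Longrightarrow> ad r (e s) = scale (of_int (N r s)) (e (r + s))"
  by (simp add: ad_def bracket_e_e eq_neg_iff_add_eq_0 add.commute)

lemma ad_e_uminus: "ad r (e (- r)) = h r"
  by (simp add: ad_def h_def)

lemma ad_h: "r \<in> E6 \<Longrightarrow> s \<in> E6 \<Longrightarrow> ad r (h s) = scale (- of_real (r \<bullet> s)) (e r)"
  by (simp add: ad_def bracket_e_h)

lemma ad_e_self: "ad r (e r) = 0"
  by (simp add: ad_def bracket_self)

text \<open>If \<open>r + s\<close> is a root, its inner product with \<open>r\<close> is 1, so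
  adding \<open>r\<close> once more gives neither a root nor zero.\<close>

lemma ad_ad_e:
  assumes "r \<in> E6" "s \<in> E6" "s \<noteq> - r"
  shows "ad r (ad r (e s)) = 0"
proof (cases "r + s \<in> E6")
  case True
  have "r \<bullet> s = -1" using E6_add_imp_inner[OF assms(1,2) True] .
  then have r: "r \<bullet> (r + s) = 1" using E6_inner_self[OF assms(1)] by (simp add: inner_add_right)
  have "r + s \<noteq> - r"
  proof
    assume "r + s = - r"
    then show False using r E6_inner_self[OF assms(1)] by (metis inner_minus_right neg_equal_iff_equal one_neq_neg_numeral)
  qed
  moreover have "r + (r + s) \<notin> E6" using E6_add_imp_inner[OF assms(1) True] r by auto
  ultimately show ?thesis using assms True by (simp add: ad_e ad_scale N_def[of r "r + s"])
qed (use assms in \<open>simp add: ad_e ad_zero N_def\<close>)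

lemma ad_ad_h: "r \<in> E6 \<Longrightarrow> s \<in> E6 \<Longrightarrow> ad r (ad r (h s)) = 0"
  by (simp add: ad_h ad_uminus ad_scale ad_e_self)

lemma ad_ad_e_uminus: "r \<in> E6 \<Longrightarrow> ad r (ad r (e (- r))) = scale (-2) (e r)"
  by (simp add: ad_e_uminus ad_h E6_inner_self)

text \<open>Among the basis vectors only \<open>e (- r)\<close> survives two applications, and its
  image, a multiple of \<open>e r\<close>, is killed by the third.\<close>

lemma ad_cubed: "r \<in> E6 \<Longrightarrow> ad r (ad r (ad r x)) = 0"
proof -
  assume r: "r \<in> E6"
  have basis: "ad r (ad r (ad r b)) = 0" if "b \<in> B" for b
    using that
  proof (cases rule: B_cases)
    case (1 s)
    then show ?thesis using r
      by (cases "s = - r") (simp_all add: ad_ad_e ad_zero ad_ad_e_uminus ad_uminus ad_scale ad_e_self)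
  qed (use r in \<open>simp_all add: ad_ad_h ad_zero\<close>)
  have "x \<in> span B" by (simp add: span_B)
  then show ?thesis
    by (induction rule: span_induct) (auto intro!: subspaceI simp: basis ad_add ad_scale ad_zero)
qed

lemma integral_ad:
  assumes r: "r \<in> E6"
  shows "integral (ad r)"
  unfolding integral_def
proof (intro conjI linear_ad ballI)
  fix b assume "b \<in> B"
  then show "ad r b \<in> lattice"
  proof (cases rule: B_cases)
    case (1 s)
    show ?thesis
    proof (cases "s = - r")
      case True
      then show ?thesis using 1 r by (simp add: ad_e_uminus h_in_lattice)
    next
      case False
      then show ?thesis using 1 r
        by (cases "r + s \<in> E6") (simp_all add: ad_e lattice_scale e_in_lattice N_def[of r s] lattice_zero lattice_uminus)
    qed
  next
    case (2 s)
    obtain k where "r \<bullet> s = of_int k" using E6_inner_Ints[OF r 2(2)] by (auto elim: Ints_cases)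
    then have "ad r b = scale (of_int (- k)) (e r)" using 2 r by (simp add: ad_h)
    then show ?thesis using r by (simp only: lattice_scale e_in_lattice)
  qed
qed

text \<open>The square of \<open>ad r\<close> is non-zero on one basis vector only, and there its
  value \<open>-2\<close> times \<open>e r\<close> is divisible by 2.\<close>

lemma integral_ad2:
  assumes r: "r \<in> E6"
  shows "integral (ad2 r)"
  unfolding integral_def
proof (intro conjI linear_ad2 ballI)
  fix b assume "b \<in> B"
  then show "ad2 r b \<in> lattice"
  proof (cases rule: B_cases)
    case (1 s)
    then show ?thesis using r
      by (cases "s = - r") (simp_all add: ad2_eq ad_ad_e ad_ad_e_uminus lattice_zero lattice_uminus e_in_lattice)
  next
    case (2 s)
    then show ?thesis using r by (simp add: ad2_eq ad_ad_h lattice_zero)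
  qed
qed

text \<open>Identifies the index set of the sum in \<open>root_elt\<close>; \<open>e (- r)\<close>
  witnesses that the exponents up to 2 do occur.\<close>

lemma ad_powers_nonzero:
  assumes r: "r \<in> E6"
  shows "{n. \<exists>y. (bracket (e r) ^^ n) y \<noteq> 0} = {0, 1, 2}"
proof -
  have "(bracket (e r) ^^ n) y = 0" if "n \<ge> 3" for n y
  proof -
    from that obtain m where "n = m + 3" by (metis add.commute le_Suc_ex)
    then show ?thesis
      using ad_cubed[OF r] by (induction m) (simp_all add: funpow_add numeral_3_eq_3 ad_def)
  qed
  then have "{n. \<exists>y. (bracket (e r) ^^ n) y \<noteq> 0} \<subseteq> {0, 1, 2}"
    by (auto simp: not_less_eq_eq numeral_eq_Suc) (metis Suc_leI le_neq_implies_less)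
  moreover have "(bracket (e r) ^^ 2) (e (- r)) \<noteq> 0" "(bracket (e r) ^^ 1) (e (- r)) \<noteq> 0"
    "(bracket (e r) ^^ 0) (e (- r)) \<noteq> 0"
    using ad_ad_e_uminus[OF r] e_nonzero[OF r] e_nonzero[OF E6_uminus[OF r]]
    by (auto simp: numeral_2_eq_2 ad_def)
  ultimately show ?thesis by blast
qed

section \<open>Root elements as quadratic polynomials in the parameter\<close>

lemma root_elt_apply:
  fixes v :: "'l \<Rightarrow> 'k::field"
  assumes r: "r \<in> E6" and v: "v \<in> lie_over e"
  shows "root_elt e r t v = (\<lambda>b\<in>B. v b + (t * base_change e (ad r) v b + t\<^sup>2 * base_change e (ad2 r) v b))"
proof -
  have "divided_power (e r) 0 = (\<lambda>x. x)" "divided_power (e r) (Suc 0) = ad r"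
    by (auto simp: divided_power_def ad_def)
  then show ?thesis
    using v unfolding root_elt_def ad_powers_nonzero[OF r]
    by (auto simp add: base_change_id ad2_def intro!: restrict_ext)
qed

lemma root_elt_in_lie_over: "r \<in> E6 \<Longrightarrow> v \<in> lie_over e \<Longrightarrow> root_elt e r t v \<in> lie_over e"
  by (simp add: root_elt_apply lie_over_def)

lemma integral_add:
  assumes "integral f" "integral g"
  shows "integral (\<lambda>x. f x + g x)"
proof -
  interpret f: Vector_Spaces.linear scale scale f using assms(1) by (rule integral_linear)
  interpret g: Vector_Spaces.linear scale scale g using assms(2) by (rule integral_linear)
  have "Vector_Spaces.linear scale scale (\<lambda>x. f x + g x)"
    by unfold_locales (simp_all add: f.add g.add f.scale g.scale scale_right_distrib ac_simps)
  then show ?thesis using assms by (simp add: integral_def lattice_add)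
qed

lemma integral_scale:
  assumes "integral f"
  shows "integral (\<lambda>x. scale (of_int k) (f x))"
proof -
  interpret f: Vector_Spaces.linear scale scale f using assms by (rule integral_linear)
  have "Vector_Spaces.linear scale scale (\<lambda>x. scale (of_int k) (f x))"
    by unfold_locales (simp_all add: f.add f.scale scale_right_distrib mult.commute)
  then show ?thesis using assms by (simp add: integral_def lattice_scale)
qed

section \<open>The commutator formula\<close>

lemma ad_cubed_commuting:
  assumes r: "r \<in> E6" and "k \<noteq> 0"
    and comm: "\<And>x. ad r (ad s x) = ad s (ad r x) + scale k (ad t x)"
    and rt: "\<And>x. ad r (ad t x) = ad t (ad r x)" and st: "\<And>x. ad s (ad t x) = ad t (ad s x)"
  shows "ad r (ad r (ad t x)) = 0" "ad r (ad t (ad t x)) = 0"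
proof -
  \<comment> \<open>Moving \<open>ad s\<close> to the left past \<open>ad r\<close> three times
    leaves three equal correction terms. The cubes vanish, and \<open>3 * k\<close> is invertible
    over the complex numbers.\<close>
  have "ad r (ad r (ad r (ad s x))) = ad s (ad r (ad r (ad r x))) + scale (3 * k) (ad r (ad r (ad t x)))" for x
    by (simp add: comm ad_add ad_scale rt scale_right_distrib flip: scale_left_distrib add.assoc)
  then show rrt: "ad r (ad r (ad t x)) = 0" for x
    using \<open>k \<noteq> 0\<close> ad_cubed[OF r] by (simp add: ad_zero)
  \<comment> \<open>Commuting \<open>ad s\<close> through the relation just obtained gives the
    second one in the same way, now with the factor \<open>2 * k\<close>.\<close>
  have "ad r (ad r (ad t (ad s x))) = ad s (ad r (ad r (ad t x))) + scale (2 * k) (ad r (ad t (ad t x)))"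
    by (simp add: comm ad_add ad_scale rt st[symmetric] scale_right_distrib flip: scale_left_distrib add.assoc)
  then show "ad r (ad t (ad t x)) = 0"
    using \<open>k \<noteq> 0\<close> by (simp add: rrt ad_zero)
qed

lemma base_change_vector_diff:
  "b \<in> B \<Longrightarrow> base_change e f (\<lambda>b. v b - w b) b = base_change e f v b - base_change e f w b"
  by (simp add: base_change_eq right_diff_distrib sum_subtractf)

lemma restrict_in_lie_over: "restrict w B \<in> lie_over e"
  by (simp add: lie_over_def)

text \<open>Both sides are polynomials in \<open>u\<close> and \<open>t\<close>. The left one is put
  into the order \<open>Y\<close>, \<open>X\<close>, \<open>Z\<close>; the coefficients then agree
  by four operator identities, proved over the complex numbers and carried to \<open>'k\<close> by
  base change.\<close>

lemma root_elt_commute: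
  fixes v :: "'l \<Rightarrow> 'k::field"
  assumes r: "r \<in> E6" and s: "s \<in> E6" and rs: "r + s \<in> E6" and v: "v \<in> lie_over e"
  shows "root_elt e r u (root_elt e s t v) =
    root_elt e s t (root_elt e r u (root_elt e (r + s) (of_int (N r s) * (t * u)) v))"
proof -
  define X X2 Y Y2 Z Z2 where XYZ: "X = ad r" "X2 = ad2 r" "Y = ad s" "Y2 = ad2 s"
    "Z = ad (r + s)" "Z2 = ad2 (r + s)"
  define n where "n = N r s"
  have nn: "n = 1 \<or> n = -1" using structure_const_cases(2)[OF r s rs] by (simp add: n_def)
  have nz: "r + s \<noteq> 0" using E6_nonzero[OF rs] .
  have inner: "r \<bullet> s = -1" using E6_add_imp_inner[OF r s rs] .
  have comm: "X (Y x) = Y (X x) + scale (of_int n) (Z x)" for x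
    using bracket_derivation[of "e r" "e s" x] r s nz
    by (simp add: XYZ ad_def n_def bracket_e_e bracket_scale_left add.commute)
  have "r + (r + s) \<noteq> 0" "r + (r + s) \<notin> E6" "s + (r + s) \<noteq> 0" "s + (r + s) \<notin> E6"
  proof -
    have 1: "r \<bullet> (r + s) = 1" "s \<bullet> (r + s) = 1"
      using inner E6_inner_self[OF r] E6_inner_self[OF s] by (simp_all add: inner_add_right inner_commute[of s r])
    show "r + (r + s) \<notin> E6" "s + (r + s) \<notin> E6"
      using E6_add_imp_inner[OF r rs] E6_add_imp_inner[OF s rs] 1 by auto
    have "r \<bullet> (r + (r + s)) = 3" "s \<bullet> (s + (r + s)) = 3"
      unfolding inner_add_right[of _ _ "r + s"] using 1 E6_inner_self[OF r] E6_inner_self[OF s] by simp_all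
    then show "r + (r + s) \<noteq> 0" "s + (r + s) \<noteq> 0" by (metis inner_zero_right zero_neq_numeral)+
  qed
  then have "bracket (e r) (e (r + s)) = 0" "bracket (e s) (e (r + s)) = 0"
    using r s rs by (simp_all add: bracket_e_e_eq_0)
  then have XZ: "X (Z x) = Z (X x)" and YZ: "Y (Z x) = Z (Y x)" for x
    using bracket_derivation[of "e r" "e (r + s)" x] bracket_derivation[of "e s" "e (r + s)" x]
    by (simp_all add: XYZ ad_def)
  have comm': "Y (X x) = X (Y x) + scale (- of_int n) (Z x)" for x
    by (simp add: comm)
  have k: "of_int n \<noteq> (0::complex)" "- of_int n \<noteq> (0::complex)" using nn by auto
  have XXZ: "X (X (Z x)) = 0" and XZZ: "X (Z (Z x)) = 0" for x
    using ad_cubed_commuting[OF r k(1), of s "r + s"] comm XZ YZ by (simp_all add: XYZ)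
  \<comment> \<open>The same argument with \<open>r\<close> and \<open>s\<close> exchanged, which
    reverses the sign of the constant.\<close>
  have YYZ: "Y (Y (Z x)) = 0" and YZZ: "Y (Z (Z x)) = 0" for x
    using ad_cubed_commuting[OF s k(2), of r "r + s"] comm' XZ YZ by (simp_all add: XYZ)
  have X2: "X2 x = scale (1/2) (X (X x))" and Y2: "Y2 x = scale (1/2) (Y (Y x))"
    and Z2: "Z2 x = scale (1/2) (Z (Z x))" for x
    by (simp_all add: XYZ ad2_eq)
  have add: "X (x + y) = X x + X y" "Y (x + y) = Y x + Y y" "Z (x + y) = Z x + Z y"
    and scale: "X (scale a x) = scale a (X x)" "Y (scale a x) = scale a (Y x)" "Z (scale a x) = scale a (Z x)"
    and zero: "X 0 = 0" "Y 0 = 0" "Z 0 = 0" for x y a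
    by (simp_all add: XYZ ad_add ad_scale ad_zero)
  \<comment> \<open>Each divided square produces two equal terms with a factor one half; their sum
    has an integral coefficient, so the resulting identities make sense over any field.\<close>
  have half: "scale (of_int n / 2) y + scale (of_int n / 2) y = scale (of_int n) y" for y
    by (simp flip: scale_left_distrib)
  have nsq: "of_int n * of_int n = (1 :: complex)" using nn by auto
  have X2Y: "X2 (Y x) = Y (X2 x) + scale (of_int n) (X (Z x))" for x
    by (simp add: X2 comm add scale XZ scale_right_distrib add.assoc half)
  have XY2: "X (Y2 x) = Y2 (X x) + scale (of_int n) (Y (Z x))" for x
    by (simp add: Y2 comm add scale YZ scale_right_distrib add.assoc half)
  \<comment> \<open>The term \<open>Z2\<close> arises with coefficient \<open>n * n = 1\<close>, so
    it carries no sign.\<close>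
  have X2Y2: "X2 (Y2 x) = Y2 (X2 x) + (scale (of_int n) (Y (X (Z x))) + Z2 x)" for x
  proof -
    have "X2 (Y2 x) = scale (1/2) (X (X (Y2 x)))" by (simp add: X2)
    also have "X (X (Y2 x)) = X (Y2 (X x)) + scale (of_int n) (X (Y (Z x)))"
      by (simp add: XY2 add scale)
    also have "\<dots> = Y2 (X (X x)) + (scale (of_int n) (Y (X (Z x))) + scale (of_int n) (Y (X (Z x)))) + Z (Z x)"
      by (simp add: XY2 comm scale_right_distrib nsq XZ add.assoc)
    also have "scale (1/2) \<dots> = Y2 (X2 x) + (scale (of_int n) (Y (X (Z x))) + Z2 x)"
      by (simp add: X2 Y2 Z2 scale scale_right_distrib add.assoc half mult.commute)
    finally show ?thesis .
  qed
  \<comment> \<open>With these products gone, \<open>Z\<close> survives next to \<open>X\<close> or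
    \<open>Y\<close> only to first order, as \<open>X \<circ> Z\<close>, \<open>Y \<circ> Z\<close>
    and \<open>Y \<circ> (X \<circ> Z)\<close>.\<close>
  have zeros: "X2 \<circ> Z = (\<lambda>x. 0)" "X \<circ> Z2 = (\<lambda>x. 0)" "X2 \<circ> Z2 = (\<lambda>x. 0)"
    "Y2 \<circ> Z = (\<lambda>x. 0)" "Y \<circ> Z2 = (\<lambda>x. 0)" "Y2 \<circ> Z2 = (\<lambda>x. 0)" "Y2 \<circ> (X \<circ> Z) = (\<lambda>x. 0)"
    "Y \<circ> (\<lambda>x. 0) = (\<lambda>x. 0)" "Y2 \<circ> (\<lambda>x. 0) = (\<lambda>x. 0)"
    by (simp_all add: fun_eq_iff X2 Y2 Z2 scale zero XXZ XZZ YYZ YZZ) (simp add: XZ YYZ)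
  have int: "integral X" "integral X2" "integral Y" "integral Y2" "integral Z" "integral Z2"
    using r s rs by (simp_all add: XYZ integral_ad integral_ad2)
  let ?D = "base_change e"
  have id: "?D (X \<circ> Y) v b = ?D (Y \<circ> X) v b + of_int n * ?D Z v b"
    "?D (X2 \<circ> Y) v b = ?D (Y \<circ> X2) v b + of_int n * ?D (X \<circ> Z) v b"
    "?D (X \<circ> Y2) v b = ?D (Y2 \<circ> X) v b + of_int n * ?D (Y \<circ> Z) v b"
    "?D (X2 \<circ> Y2) v b = ?D (Y2 \<circ> X2) v b + (of_int n * ?D (Y \<circ> (X \<circ> Z)) v b + ?D Z2 v b)"
    if "b \<in> B" for b
  proof -
    have "X \<circ> Y = (\<lambda>x. (Y \<circ> X) x + scale (of_int n) (Z x))"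
      "X2 \<circ> Y = (\<lambda>x. (Y \<circ> X2) x + scale (of_int n) ((X \<circ> Z) x))"
      "X \<circ> Y2 = (\<lambda>x. (Y2 \<circ> X) x + scale (of_int n) ((Y \<circ> Z) x))"
      "X2 \<circ> Y2 = (\<lambda>x. (Y2 \<circ> X2) x + (scale (of_int n) ((Y \<circ> (X \<circ> Z)) x) + Z2 x))"
      by (simp_all add: fun_eq_iff comm X2Y XY2 X2Y2)
    then show "?D (X \<circ> Y) v b = ?D (Y \<circ> X) v b + of_int n * ?D Z v b"
      "?D (X2 \<circ> Y) v b = ?D (Y \<circ> X2) v b + of_int n * ?D (X \<circ> Z) v b"
      "?D (X \<circ> Y2) v b = ?D (Y2 \<circ> X) v b + of_int n * ?D (Y \<circ> Z) v b"
      "?D (X2 \<circ> Y2) v b = ?D (Y2 \<circ> X2) v b + (of_int n * ?D (Y \<circ> (X \<circ> Z)) v b + ?D Z2 v b)"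
      using that by (simp_all only: base_change_add base_change_scale int integral_comp integral_add integral_scale)
  qed
  have act: "root_elt e r a w = (\<lambda>b\<in>B. w b + (a * ?D X w b + a\<^sup>2 * ?D X2 w b))"
    "root_elt e s a w = (\<lambda>b\<in>B. w b + (a * ?D Y w b + a\<^sup>2 * ?D Y2 w b))"
    "root_elt e (r + s) a w = (\<lambda>b\<in>B. w b + (a * ?D Z w b + a\<^sup>2 * ?D Z2 w b))"
    if "w \<in> lie_over e" for a and w :: "'l \<Rightarrow> 'k"
    using that r s rs by (simp_all add: root_elt_apply XYZ)
  show ?thesis
    unfolding n_def[symmetric]
  proof
    fix b
    show "root_elt e r u (root_elt e s t v) b =
        root_elt e s t (root_elt e r u (root_elt e (r + s) (of_int n * (t * u)) v)) b"
    proof (cases "b \<in> B")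
      case True
      have "root_elt e r u (root_elt e s t v) b =
         v b + (t * ?D Y v b + t\<^sup>2 * ?D Y2 v b) + (u * (?D X v b + (t * ?D (X \<circ> Y) v b + t\<^sup>2 * ?D (X \<circ> Y2) v b))
         + u\<^sup>2 * (?D X2 v b + (t * ?D (X2 \<circ> Y) v b + t\<^sup>2 * ?D (X2 \<circ> Y2) v b)))"
        using True by (simp add: act restrict_in_lie_over v base_change_restrict base_change_vector_add
            base_change_vector_scale base_change_comp int cong: restrict_cong)
      \<comment> \<open>The parameter \<open>a\<close> of the third root element is kept general
        here. Substituting \<open>of_int n * (t * u)\<close> afterwards makes its square lose the
        sign \<open>n\<close>, which matches the coefficient of \<open>Z2\<close> on the other
        side.\<close>
      moreover have "root_elt e s t (root_elt e r u (root_elt e (r + s) a v)) b =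
         v b + a * ?D Z v b + a\<^sup>2 * ?D Z2 v b + u * (?D X v b + a * ?D (X \<circ> Z) v b) + u\<^sup>2 * ?D X2 v b
         + t * (?D Y v b + a * ?D (Y \<circ> Z) v b
           + u * (?D (Y \<circ> X) v b + a * ?D (Y \<circ> (X \<circ> Z)) v b) + u\<^sup>2 * ?D (Y \<circ> X2) v b)
         + t\<^sup>2 * (?D Y2 v b + u * ?D (Y2 \<circ> X) v b + u\<^sup>2 * ?D (Y2 \<circ> X2) v b)" for a
        using True by (simp add: act restrict_in_lie_over v base_change_restrict base_change_vector_add base_change_vector_scale
            base_change_comp int integral_comp zeros base_change_zero algebra_simps cong: restrict_cong)
      moreover have "(of_int n * (t * u))\<^sup>2 = t\<^sup>2 * u\<^sup>2"
        using nn by (auto simp: power_mult_distrib)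
      ultimately show ?thesis
        using True by (simp only: id) (simp add: algebra_simps power2_eq_square)
    next
      case False
      then show ?thesis by (simp add: act restrict_in_lie_over v)
    qed
  qed
qed

section \<open>Root elements inside the Chevalley group\<close>

lemma root_elt_inverse:
  fixes v :: "'l \<Rightarrow> 'k::field"
  assumes r: "r \<in> E6" and v: "v \<in> lie_over e"
  shows "root_elt e r t (root_elt e r (- t) v) = v"
proof
  fix b
  let ?D = "base_change e :: _ \<Rightarrow> ('l \<Rightarrow> 'k) \<Rightarrow> _"
  \<comment> \<open>Hence in the product with parameters \<open>t\<close> and \<open>- t\<close> the
    linear terms cancel, and the quadratic part is
    \<open>t\<^sup>2 + t\<^sup>2 - 2 * t\<^sup>2\<close>, that is, zero.\<close>
  have "ad r \<circ> ad r = (\<lambda>x. scale (of_int 2) (ad2 r x))" "ad r \<circ> ad2 r = (\<lambda>x. 0)"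
    "ad2 r \<circ> ad r = (\<lambda>x. 0)" "ad2 r \<circ> ad2 r = (\<lambda>x. 0)"
    by (simp_all add: fun_eq_iff ad2_eq ad_scale ad_cubed r ad_zero)
  then have D: "?D (ad r \<circ> ad r) v b = of_int 2 * ?D (ad2 r) v b" "?D (ad r \<circ> ad2 r) v b = 0"
    "?D (ad2 r \<circ> ad r) v b = 0" "?D (ad2 r \<circ> ad2 r) v b = 0" if "b \<in> B"
    using that by (simp_all only: base_change_scale base_change_zero integral_ad2 r)
  show "root_elt e r t (root_elt e r (- t) v) b = v b"
  proof (cases "b \<in> B")
    case True
    then show ?thesis
      using r D
      by (simp add: root_elt_apply[OF r] v restrict_in_lie_over base_change_restrict base_change_vector_add base_change_vector_diff
          base_change_vector_scale base_change_comp integral_ad integral_ad2 algebra_simps power2_eq_square)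
  next
    case False
    then show ?thesis using v root_elt_in_lie_over[OF r root_elt_in_lie_over[OF r v]]
      unfolding lie_over_def by (metis PiE_arb)
  qed
qed

lemma root_elt_in_Bij:
  assumes r: "r \<in> E6"
  shows "(root_elt e r t :: ('l \<Rightarrow> 'k::field) \<Rightarrow> _) \<in> Bij (lie_over e)"
proof -
  have "bij_betw (root_elt e r t :: ('l \<Rightarrow> 'k) \<Rightarrow> _) (lie_over e) (lie_over e)"
  proof (rule bij_betw_byWitness[where f' = "root_elt e r (- t)"])
    show "\<forall>v\<in>lie_over e. root_elt e r (- t) (root_elt e r t v) = (v :: 'l \<Rightarrow> 'k)"
      using root_elt_inverse[OF r, of _ "- t"] by simp
    show "\<forall>v\<in>lie_over e. root_elt e r t (root_elt e r (- t) v) = (v :: 'l \<Rightarrow> 'k)"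
      by (intro ballI root_elt_inverse[OF r])
  qed (use root_elt_in_lie_over[OF r] in blast)+
  then show ?thesis by (simp add: Bij_def root_elt_def)
qed

lemma chevalley_commutator:
  assumes r: "r \<in> E6" and s: "s \<in> E6" and rs: "r + s \<in> E6"
  shows "group_commutator (chevalley_group e) (root_elt e r u) (root_elt e s (t :: 'k::field)) =
    root_elt e (r + s) (of_int (N r s) * (t * u))"
proof -
  let ?G = "BijGroup (lie_over e :: ('l \<Rightarrow> 'k) set)"
  let ?S = "{root_elt e r t | r (t :: 'k). r \<in> E6}"
  interpret Bij: group ?G by (rule group_BijGroup)
  interpret G: group "chevalley_group e :: (('l \<Rightarrow> 'k) \<Rightarrow> _) monoid"
    unfolding chevalley_group_def by (rule Bij.group_subgroup_generated)
  have carrier: "root_elt e r t \<in> carrier (chevalley_group e)" if "r \<in> E6" for r and t :: 'k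
    using that unfolding chevalley_group_def carrier_subgroup_generated
    by (intro generate.incl) (auto simp: BijGroup_def root_elt_in_Bij)
  \<comment> \<open>Multiplication in \<open>BijGroup\<close> is composition only when both
    arguments are in \<open>Bij\<close>, so this membership has to be supplied at each use.\<close>
  have mult: "root_elt e r' t' \<otimes>\<^bsub>chevalley_group e\<^esub> f = compose (lie_over e) (root_elt e r' t') f"
    if "r' \<in> E6" "f \<in> Bij (lie_over e)" for r' and t' :: 'k and f
    using that by (simp add: chevalley_group_def BijGroup_def root_elt_in_Bij)
  show ?thesis
  proof (rule G.group_commutator_eqI)
    show "root_elt e r u \<otimes>\<^bsub>chevalley_group e\<^esub> root_elt e s t =
        root_elt e s t \<otimes>\<^bsub>chevalley_group e\<^esub>
        (root_elt e r u \<otimes>\<^bsub>chevalley_group e\<^esub> root_elt e (r + s) (of_int (N r s) * (t * u)))"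
      using r s rs
      by (simp add: mult root_elt_in_Bij compose_Bij) (simp add: compose_def root_elt_commute restrict_def fun_eq_iff)
  qed (use r s rs carrier in auto)
qed

end

theorem mainTheorem3:
  fixes scale :: "complex \<Rightarrow> 'l::ab_group_add \<Rightarrow> 'l"
    and bracket :: "'l \<Rightarrow> 'l \<Rightarrow> 'l"
    and H :: "'l set"
    and \<phi> :: "real ^ 8 \<Rightarrow> 'l \<Rightarrow> complex"
    and e :: "real ^ 8 \<Rightarrow> 'l"
    and G :: "(('l \<Rightarrow> 'k::field) \<Rightarrow> ('l \<Rightarrow> 'k)) monoid"
    and x :: "real ^ 8 \<Rightarrow> 'k \<Rightarrow> ('l \<Rightarrow> 'k) \<Rightarrow> ('l \<Rightarrow> 'k)"
    and p q :: "real ^ 8"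
    and u t :: 'k
  assumes "complex_lie_algebra scale bracket"
    and "complex_lie_algebra.simple_of_type_E6 scale bracket H \<phi>"
    and "complex_lie_algebra.chevalley_basis scale bracket H \<phi> e"
    and "\<And>r s. extraspecial r s \<Longrightarrow> complex_lie_algebra.structure_const scale bracket e r s = 1"
  defines "G \<equiv> complex_lie_algebra.chevalley_group scale bracket e"
    and "x \<equiv> complex_lie_algebra.root_elt scale bracket e"
  assumes "p \<in> positive_roots" and "q \<in> positive_roots" and "p \<prec> q" and "p + q \<in> E6"
  shows "group_commutator G (x p u) (x q t) = x (p + q) (eta p q * (t * u)) \<and>
         group_commutator G (x (- p) u) (x (- q) t) = x (- p - q) (- eta p q * (t * u)) \<and>
         group_commutator G (x p u) (x (- p - q) t) = x (- q) (- eta p q * (t * u)) \<and>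
         group_commutator G (x q u) (x (- p - q) t) = x (- p) (eta p q * (t * u))"
proof -
  interpret E6_chevalley scale bracket H \<phi> e
    using assms(1-3) by (simp add: E6_chevalley_def E6_chevalley_axioms_def)
  have p: "p \<in> E6" and q: "q \<in> E6" and pq: "p + q \<in> E6"
    using \<open>p \<in> positive_roots\<close> \<open>q \<in> positive_roots\<close> \<open>p + q \<in> E6\<close> by (simp_all add: positive_roots_def)
  note neg = E6_uminus[OF p] E6_uminus[OF q] E6_uminus[OF pq]
  have "N r s = 1" if "extraspecial r s" for r s
    using that assms(4)[OF that] by (simp add: N_def extraspecial_def special_def)
  then have eta: "of_int (N p q) = (eta p q :: 'k)"
    by (intro signs_determined N_swap N_square N_assoc) (use assms in auto)
  \<comment> \<open>This swap is the source of the minus sign in the third formula. In the fourth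
    the arguments are already in cyclic order, and in the second the sign comes from
    \<open>N_uminus\<close>.\<close>
  have "N p (- (p + q)) = - N p q"
    using N_swap[of "- (p + q)" p] N_cyclic(2)[OF p q pq] p neg by simp
  then show ?thesis
    unfolding G_def x_def
    using chevalley_commutator[OF p q, of u t] chevalley_commutator[OF neg(1,2), of u t]
      chevalley_commutator[OF p neg(3), of u t] chevalley_commutator[OF q neg(3), of u t]
      N_uminus[OF p q pq] N_cyclic(1)[OF p q pq] pq neg
    by (simp add: eta)
qed

end
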